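(* Let $X,Y$ be Hilbert spaces, $A\colon X\to Y$ a bounded linear operator, and $\Phi\colon X\to X$ a Lipschitz continuous map with $\Phi(X)\subseteq\ker(A)$. Let $\mu,\rho>0$ and let $(g_\alpha)_{\alpha>0}$ be a regularizing filter such that there exist constants $\alpha_0,c_1,c_2>0$ with - for all $\alpha>0$ and all $\lambda\in[0,\|A^*A\|]$: $\lambda^\mu|1-\lambda g_\alpha(\lambda)|\le c_1\alpha^\mu$; - for all $\alpha\in(0,\alpha_0)$: $\|g_\alpha\|_\infty\le c_2/\alpha$. Set $R_\alpha:=(\mathrm{Id}_X+\Phi)\circ g_\alpha(A^*A)A^*$ and $$\mathcal M_{\mu,\rho,\Phi}:=(\mathrm{Id}_X+\Phi)\Big((A^*A)^\mu\big(\overline{B_\rho(0)}\big)\Big).$$ Let $\alpha^\star\colon(0,\infty)\times Y\to(0,\infty)$ be a parameter choice (possibly depending on $\mathcal M_{\mu,\rho,\Phi}$) satisfying $\alpha^\star\asymp(\delta/\rho)^{\frac{2}{2\mu+1}}$ as $\delta\to0$. Then there exists a constant $c>0$ such that, for all sufficiently small $\delta>0$, $$\sup\big\{\|R_{\alpha^\star(\delta,y^\delta)}(y^\delta)-x\|\ \big|\ x\in\mathcal M_{\mu,\rho,\Phi},\ y^\delta\in Y,\ \|Ax-y^\delta\|\le\delta\big\}\le c\,\delta^{\frac{2\mu}{2\mu+1}}\rho^{\frac1{2\mu+1}}.$$ In particular, for any $x\in\operatorname{ran}\big((\mathrm{Id}_X+\Phi)\circ(A^*A)^\mu\big)$ one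 has, as $\delta\to0$ and for $y^\delta\in Y$ with $\|Ax-y^\delta\|\le\delta$, the convergence rate $\|R_{\alpha^\star(\delta,y^\delta)}(y^\delta)-x\|=\mathcal O\big(\delta^{\frac{2\mu}{2\mu+1}}\big)$.
   Context: A family $(g_\alpha)_{\alpha>0}$ of functions $g_\alpha\colon[0,\|A^*A\|]\to\mathbb R$ is called a regularizing filter if: each $g_\alpha$ is piecewise continuous; there is $C>0$ with $\sup\{|\lambda g_\alpha(\lambda)|\mid\alpha>0,\ \lambda\in[0,\|A^*A\|]\}\le C$; and $\lim_{\alpha\to0}g_\alpha(\lambda)=1/\lambda$ for all $\lambda\in(0,\|A^*A\|]$. The operators $g_\alpha(A^*A)$ and $(A^*A)^\mu$ are defined by the functional calculus for the bounded self-adjoint operator $A^*A$. $\overline{B_\rho(0)}$ is the closed ball of radius $\rho$ around $0$ in $X$. Notation: $\alpha^\star\asymp(\delta/\rho)^a$ as $\delta\to0$ means that there are constants $d_1,d_2>0$ such that $d_1(\delta/\rho)^a\le\alpha^\star(\delta,y^\delta)\le d_2(\delta/\rho)^a$ for all sufficiently small $\delta>0$ and all $y^\delta\in Y$. *)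

theory Defs
  imports "HOL-Analysis.Analysis" "HOL-Library.Landau_Symbols"
begin

definition selfadjoint :: "('a::real_inner \<Rightarrow> 'a) \<Rightarrow> bool" where
  "selfadjoint G \<longleftrightarrow> (\<forall>x y. G x \<bullet> y = x \<bullet> G y)"

definition orthogonal_projection :: "('a::real_inner \<Rightarrow> 'a) \<Rightarrow> bool" where
  "orthogonal_projection P \<longleftrightarrow> bounded_linear P \<and> P \<circ> P = P \<and> selfadjoint P"

definition projection_valued_measure :: "(real set \<Rightarrow> 'a::real_inner \<Rightarrow> 'a) \<Rightarrow> bool" where
  "projection_valued_measure E \<longleftrightarrow>
     (\<forall>S\<in>sets borel. orthogonal_projection (E S)) \<and>
     E UNIV = id \<and>
     (\<forall>F :: nat \<Rightarrow> real set. range F \<subseteq> sets borel \<longrightarrow> disjoint_family F \<longrightarrow>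
        (\<forall>x. (\<lambda>n. E (F n) x) sums E (\<Union>n. F n) x))"

definition scalar_spectral_measure ::
    "(real set \<Rightarrow> 'a::real_inner \<Rightarrow> 'a) \<Rightarrow> 'a \<Rightarrow> real measure" where
  "scalar_spectral_measure E x = measure_of UNIV (sets borel) (\<lambda>S. ennreal (E S x \<bullet> x))"

(* G is the operator \<integral>\<^bsub>K\<^esub> g dE for a real-valued g bounded and measurable on K. By
   polarization a self-adjoint operator is determined by its quadratic form, so there is at
   most one such G, and no signed measures S \<mapsto> E S x \<bullet> y are needed. *)
definition has_spectral_integral ::
    "(real set \<Rightarrow> 'a::real_inner \<Rightarrow> 'a) \<Rightarrow> real set \<Rightarrow> (real \<Rightarrow> real) \<Rightarrow> ('a \<Rightarrow> 'a) \<Rightarrow> bool" where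
  "has_spectral_integral E K g G \<longleftrightarrow>
     bounded_linear G \<and> selfadjoint G \<and>
     (\<forall>x. G x \<bullet> x = (LINT t:K|scalar_spectral_measure E x. g t))"

(* The spectral resolution of a bounded self-adjoint operator T \<ge> 0 on a Hilbert space. The
   spectrum of T lies in [0, onorm T]. By the spectral theorem E exists and its values on
   Borel sets are unique; its values on other sets are unspecified and never used. *)
definition spectral_resolution :: "('a::real_inner \<Rightarrow> 'a) \<Rightarrow> real set \<Rightarrow> 'a \<Rightarrow> 'a" where
  "spectral_resolution T =
     (SOME E. projection_valued_measure E \<and> E {0..onorm T} = id \<and>
              has_spectral_integral E {0..onorm T} (\<lambda>t. t) T)"

(* g(T) for T as above and g bounded and Borel measurable on [0, onorm T]; the values of g
   outside this interval are irrelevant. *)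
definition functional_calculus ::
    "('a::real_inner \<Rightarrow> 'a) \<Rightarrow> (real \<Rightarrow> real) \<Rightarrow> 'a \<Rightarrow> 'a" where
  "functional_calculus T g =
     (THE G. has_spectral_integral (spectral_resolution T) {0..onorm T} g G)"

(* Finitely many discontinuities in [a, b], with finite one-sided limits everywhere. *)
definition piecewise_continuous_on :: "real \<Rightarrow> real \<Rightarrow> (real \<Rightarrow> real) \<Rightarrow> bool" where
  "piecewise_continuous_on a b g \<longleftrightarrow>
     (\<exists>S. finite S \<and> continuous_on ({a..b} - S) g) \<and>
     (\<forall>t\<in>{a<..b}. \<exists>l. (g \<longlongrightarrow> l) (at_left t)) \<and>
     (\<forall>t\<in>{a..<b}. \<exists>l. (g \<longlongrightarrow> l) (at_right t))"

(* Suprema are taken in ereal, where they are meaningful for unbounded sets, too. *)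
definition regularizing_filter :: "real \<Rightarrow> (real \<Rightarrow> real \<Rightarrow> real) \<Rightarrow> bool" where
  "regularizing_filter b g \<longleftrightarrow>
     (\<forall>\<alpha>>0. piecewise_continuous_on 0 b (g \<alpha>)) \<and>
     (\<exists>C>0. Sup {ereal \<bar>t * g \<alpha> t\<bar> | \<alpha> t. \<alpha> > 0 \<and> t \<in> {0..b}} \<le> ereal C) \<and>
     (\<forall>t\<in>{0<..b}. ((\<lambda>\<alpha>. g \<alpha> t) \<longlongrightarrow> 1 / t) (at_right 0))"

definition reconstruction ::
    "('a::real_inner \<Rightarrow> 'b::real_inner) \<Rightarrow> ('a \<Rightarrow> 'a) \<Rightarrow> (real \<Rightarrow> real \<Rightarrow> real) \<Rightarrow> real \<Rightarrow> 'b \<Rightarrow> 'a" where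
  "reconstruction A \<Phi> g \<alpha> =
     (\<lambda>z. z + \<Phi> z) \<circ> functional_calculus (adjoint A \<circ> A) (g \<alpha>) \<circ> adjoint A"

definition source_operator ::
    "('a::real_inner \<Rightarrow> 'b::real_inner) \<Rightarrow> real \<Rightarrow> 'a \<Rightarrow> 'a" where
  "source_operator A \<mu> = functional_calculus (adjoint A \<circ> A) (\<lambda>t. t powr \<mu>)"

definition source_set ::
    "('a::real_inner \<Rightarrow> 'b::real_inner) \<Rightarrow> ('a \<Rightarrow> 'a) \<Rightarrow> real \<Rightarrow> real \<Rightarrow> 'a set" where
  "source_set A \<Phi> \<mu> \<rho> = (\<lambda>z. z + \<Phi> z) ` source_operator A \<mu> ` cball 0 \<rho>"

(* \<alpha>s \<asymp> h as \<delta> \<rightarrow> 0, uniformly in the data y *)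
definition same_order :: "(real \<Rightarrow> 'b \<Rightarrow> real) \<Rightarrow> (real \<Rightarrow> real) \<Rightarrow> bool" where
  "same_order \<alpha>s h \<longleftrightarrow>
     (\<exists>d1>0. \<exists>d2>0. \<forall>\<^sub>F \<delta> in at_right 0. \<forall>y. d1 * h \<delta> \<le> \<alpha>s \<delta> y \<and> \<alpha>s \<delta> y \<le> d2 * h \<delta>)"

end

(* With T = A* A, z = T^mu w and p = g_alpha(T) A* y, the reconstruction error is at most (1 + L)
   times the norm of p - z, because Phi is Lipschitz and A z = A (z + Phi z). This splits into the
   approximation error (g_alpha(T) T - 1) T^mu w, of norm at most c1 alpha^mu times that of w, and
   the propagated data error g_alpha(T) A* (y - A z), for which |t g(t)^2| <= C c2 / alpha gives
   the factor sqrt (C c2 / alpha). The choice of alpha balances the two.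

   The functional calculus requires the spectral theorem. The numbers (S^j (1 - S)^l x, x) with
   S = T / onorm T are nonnegative, so (T^k x, x) is a Hausdorff moment sequence, with a
   representing measure m x. A finite signed measure on a compact set is determined by its
   moments; this makes the quadratic forms x |-> integral of f by m x the forms of operators, for
   every bounded Borel f, and makes these operators multiplicative in f. The same argument, with
   indicator functions in place of monomials, yields the calculus of an arbitrary
   projection-valued measure. *)

theory Submission
  imports Defs "HOL-Probability.Helly_Selection"
begin

section \<open>Riesz representation and adjoints\<close>

text \<open>\<open>functional_calculus\<close> rests on a resolution picked by \<open>SOME\<close>,
  of which only the axioms are known. The spectral theorem shows that there is something to pick;
  the calculus used in the error estimate is then rebuilt from an arbitrary projection-valued
  measure. This is why the calculus is set up once, over an abstract family of measures
  \<open>m x\<close> with a determining family of functions, and instantiated twice. The measures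
  are given separately for each \<open>x\<close>, so linearity in \<open>x\<close> and
  multiplicativity in \<open>f\<close> are not visible in them. Each is obtained by comparing two
  functionals of \<open>f\<close> that agree on the determining functions.

  The exponent of the parameter choice comes from equating
  \<open>\<alpha> powr \<mu> * \<rho>\<close>, the size of the approximation error, with
  \<open>\<delta> / sqrt \<alpha>\<close>, that of the data error: this forces
  \<open>\<alpha>\<close> to be of order
  \<open>(\<delta> / \<rho>) powr (2 / (2 * \<mu> + 1))\<close>.\<close>

lemma riesz_representation:
  fixes \<phi> :: "'a::{real_inner, complete_space} \<Rightarrow> real"
  assumes "bounded_linear \<phi>"
  shows "\<exists>z. \<forall>y. \<phi> y = z \<bullet> y"
proof -
  interpret \<phi>: bounded_linear \<phi> by fact
  obtain K where K: "\<And>x. norm (\<phi> x) \<le> norm x * K"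
    using \<phi>.bounded by blast
  \<comment> \<open>If \<open>z\<close> represents \<open>\<phi>\<close>, then \<open>J x\<close>
    equals \<open>norm (x - z) ^ 2 - norm z ^ 2\<close>, so the vector sought is the minimizer of
    \<open>J\<close>.\<close>
  define J where "J x = norm x ^ 2 - 2 * \<phi> x" for x
  define m where "m = Inf (range J)"
  have "J x \<ge> - (K\<^sup>2)" for x
  proof -
    have "\<phi> x \<le> norm x * K" using K[of x] by simp
    moreover have "0 \<le> (norm x - K)\<^sup>2" by simp
    ultimately show ?thesis by (simp add: J_def power2_eq_square algebra_simps)
  qed
  then have bdd: "bdd_below (range J)" by (auto intro!: bdd_belowI)
  have m_le: "m \<le> J x" for x
    unfolding m_def by (rule cInf_lower) (use bdd in auto)
  have "\<exists>x. J x < m + inverse (real (Suc n))" for n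
  proof -
    have "\<exists>v\<in>range J. v < m + inverse (real (Suc n))"
      using cInf_lessD[of "range J" "m + inverse (real (Suc n))"] by (auto simp: m_def)
    then show ?thesis by blast
  qed
  then obtain X where X: "\<And>n. J (X n) < m + inverse (real (Suc n))" by metis
  \<comment> \<open>Parallelogram law: the linear terms of \<open>J\<close> cancel, and the midpoint
    has value at least \<open>m\<close>, so near-minimizers are close to each other.\<close>
  have par: "(norm (X k - X l))\<^sup>2 \<le> 2 * inverse (real (Suc k)) + 2 * inverse (real (Suc l))" for k l
  proof -
    have "(norm (X k - X l))\<^sup>2 = 2 * J (X k) + 2 * J (X l) - 4 * J ((1/2) *\<^sub>R (X k + X l))"
      by (simp add: J_def \<phi>.scaleR \<phi>.add power_mult_distrib power2_norm_eq_inner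
          inner_simps inner_commute field_simps)
    also have "\<dots> \<le> 2 * inverse (real (Suc k)) + 2 * inverse (real (Suc l))"
      using X[of k] X[of l] m_le[of "(1/2) *\<^sub>R (X k + X l)"] by linarith
    finally show ?thesis .
  qed
  have "Cauchy X"
  proof (rule metric_CauchyI)
    fix e :: real assume "e > 0"
    then obtain N where N: "inverse (real (Suc N)) < e\<^sup>2 / 4"
      using reals_Archimedean[of "e\<^sup>2 / 4"] by auto
    have "dist (X k) (X l) < e" if "k \<ge> N" "l \<ge> N" for k l
    proof -
      have "inverse (real (Suc k)) \<le> inverse (real (Suc N))"
        "inverse (real (Suc l)) \<le> inverse (real (Suc N))"
        using that by (auto intro!: le_imp_inverse_le)
      with par[of k l] N have "(norm (X k - X l))\<^sup>2 < e\<^sup>2" by linarith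
      then show ?thesis using \<open>e > 0\<close> by (simp add: dist_norm power_less_imp_less_base)
    qed
    then show "\<exists>M. \<forall>k\<ge>M. \<forall>l\<ge>M. dist (X k) (X l) < e" by blast
  qed
  then obtain z where z: "X \<longlonglongrightarrow> z" using Cauchy_convergent convergent_def by blast
  have "(\<lambda>n. J (X n)) \<longlonglongrightarrow> J z"
    unfolding J_def by (intro tendsto_intros \<phi>.tendsto z)
  moreover have "(\<lambda>n. m + inverse (real (Suc n))) \<longlonglongrightarrow> m + 0"
    by (intro tendsto_intros LIMSEQ_inverse_real_of_nat)
  ultimately have "J z \<le> m + 0"
    by (rule LIMSEQ_le) (use X less_imp_le in blast)
  then have min: "J z \<le> J x" for x using m_le[of x] by simp
  have "\<phi> y = z \<bullet> y" for y
  proof (cases "y = 0")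
    case False
    define d where "d = z \<bullet> y - \<phi> y"
    \<comment> \<open>The minimizer of the quadratic polynomial
      \<open>2 * s * d + s\<^sup>2 * (norm y)\<^sup>2\<close> in \<open>s\<close>, the change of
      \<open>J\<close> along \<open>y\<close>.\<close>
    define s where "s = - d / (norm y)\<^sup>2"
    have "J (z + s *\<^sub>R y) = J z + 2 * s * d + s\<^sup>2 * (norm y)\<^sup>2"
      by (simp add: J_def d_def \<phi>.scaleR \<phi>.add power_mult_distrib power2_norm_eq_inner
          inner_simps inner_commute power2_eq_square[of s] algebra_simps)
    moreover have "2 * s * d + s\<^sup>2 * (norm y)\<^sup>2 = - (d\<^sup>2 / (norm y)\<^sup>2)"
      using False by (simp add: s_def field_simps power2_eq_square)
    ultimately have "d\<^sup>2 / (norm y)\<^sup>2 \<le> 0" using min[of "z + s *\<^sub>R y"] by linarith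
    then have "d = 0" using False by (simp add: divide_le_0_iff)
    then show ?thesis by (simp add: d_def)
  qed (simp add: \<phi>.zero)
  then show ?thesis by blast
qed

text \<open>\<open>adjoint\<close> is defined by a choice operator, so its characteristic identity
  hinges on existence, which Riesz representation supplies for each \<open>y\<close>.\<close>

lemma inner_adjoint:
  fixes A :: "'a::{real_inner, complete_space} \<Rightarrow> 'b::real_inner"
  assumes "bounded_linear A"
  shows "A x \<bullet> y = x \<bullet> adjoint A y"
proof -
  have "\<exists>z. \<forall>x. A x \<bullet> y = x \<bullet> z" for y
    using riesz_representation[OF bounded_linear_compose[OF bounded_linear_inner_left assms, of y]]
    by (metis inner_commute)
  then have "\<exists>B. \<forall>x y. A x \<bullet> y = x \<bullet> B y" by metis
  then have "\<forall>x y. A x \<bullet> y = x \<bullet> adjoint A y"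
    unfolding adjoint_def by (rule someI_ex)
  then show ?thesis by blast
qed

lemma eq_if_inner_eq:
  fixes x y :: "'a::real_inner"
  assumes "\<And>z. x \<bullet> z = y \<bullet> z"
  shows "x = y"
proof -
  have "(x - y) \<bullet> (x - y) = 0" using assms[of "x - y"] by (simp add: inner_diff_left)
  then show ?thesis by simp
qed

text \<open>Serves operators known only through their inner products: \<open>adjoint A\<close>, and
  later \<open>Op f\<close>. Testing the form at \<open>y = G x\<close> turns a bound on the form
  into one on \<open>norm (G x)\<close>.\<close>

lemma bounded_linear_form:
  fixes B :: "'b::real_inner \<Rightarrow> 'a::real_inner \<Rightarrow> real" and G :: "'b \<Rightarrow> 'a"
  assumes G: "\<And>x y. G x \<bullet> y = B x y"
    and add: "\<And>x x' y. B (x + x') y = B x y + B x' y"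
    and scale: "\<And>c x y. B (c *\<^sub>R x) y = c * B x y"
    and bound: "\<And>x y. \<bar>B x y\<bar> \<le> K * norm x * norm y"
    and K: "0 \<le> K"
  shows "bounded_linear G"
proof (rule bounded_linear_intro)
  show "G (x + y) = G x + G y" for x y
    by (rule eq_if_inner_eq) (simp add: inner_add_left G add)
  show "G (c *\<^sub>R x) = c *\<^sub>R G x" for c x
    by (rule eq_if_inner_eq) (simp add: G scale)
  show "norm (G x) \<le> norm x * K" for x
  proof (cases "G x = 0")
    case False
    have "norm (G x) * norm (G x) = B x (G x)"
      by (simp flip: G power2_norm_eq_inner add: power2_eq_square)
    also have "\<dots> \<le> (norm x * K) * norm (G x)"
      using bound[of x "G x"] by (simp add: mult_ac)
    finally show ?thesis using False by simp
  qed (simp add: K)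
qed

lemma bounded_linear_adjoint:
  fixes A :: "'a::{real_inner, complete_space} \<Rightarrow> 'b::real_inner"
  assumes A: "bounded_linear A"
  shows "bounded_linear (adjoint A)"
proof (rule bounded_linear_form[where B = "\<lambda>y x. A x \<bullet> y" and K = "onorm A"])
  interpret A: bounded_linear A by fact
  show "adjoint A y \<bullet> x = A x \<bullet> y" for x y by (metis inner_adjoint[OF A] inner_commute)
  show "\<bar>A x \<bullet> y\<bar> \<le> onorm A * norm y * norm x" for x y
    using Cauchy_Schwarz_ineq2[of "A x" y] mult_right_mono[OF onorm[OF A, of x], of "norm y"]
    by (simp add: mult_ac)
qed (auto simp: inner_add_right onorm_pos_le[OF A])

text \<open>Over the reals a quadratic form sees only the symmetric part of a bilinear form;
  self-adjointness makes the two mixed terms equal.\<close>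

lemma inner_polarization:
  fixes G :: "'a::real_inner \<Rightarrow> 'a"
  assumes "bounded_linear G" "selfadjoint G"
  shows "G x \<bullet> y = (G (x + y) \<bullet> (x + y) - G (x - y) \<bullet> (x - y)) / 4"
proof -
  interpret bounded_linear G by fact
  have "G y \<bullet> x = G x \<bullet> y" using assms(2) by (metis selfadjoint_def inner_commute)
  then show ?thesis by (simp add: add diff inner_simps)
qed

lemma selfadjoint_eqI:
  fixes G H :: "'a::real_inner \<Rightarrow> 'a"
  assumes "bounded_linear G" "selfadjoint G" "bounded_linear H" "selfadjoint H"
    and "\<And>x. G x \<bullet> x = H x \<bullet> x"
  shows "G = H"
proof
  fix x
  show "G x = H x"
    by (rule eq_if_inner_eq) (metis inner_polarization[OF assms(1,2)]
        inner_polarization[OF assms(3,4)] assms(5))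
qed

section \<open>Bounded Borel functions and sigma-continuous functionals\<close>

text \<open>The bound is asked for on \<open>K\<close> alone, so that for compact \<open>K\<close>
  the monomials belong to the class without being cut off.\<close>

definition bounded_borel_on :: "real set \<Rightarrow> (real \<Rightarrow> real) set" where
  "bounded_borel_on K = {f \<in> borel_measurable borel. \<exists>B. \<forall>t\<in>K. \<bar>f t\<bar> \<le> B}"

lemma bounded_borel_onI:
  "f \<in> borel_measurable borel \<Longrightarrow> (\<And>t. t \<in> K \<Longrightarrow> \<bar>f t\<bar> \<le> B) \<Longrightarrow> f \<in> bounded_borel_on K"
  by (auto simp: bounded_borel_on_def)

lemma bounded_borel_onE:
  assumes "f \<in> bounded_borel_on K"
  obtains B where "f \<in> borel_measurable borel" "0 \<le> B" "\<forall>t\<in>K. \<bar>f t\<bar> \<le> B"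
proof -
  obtain B where B: "f \<in> borel_measurable borel" "\<And>t. t \<in> K \<Longrightarrow> \<bar>f t\<bar> \<le> B"
    using assms by (auto simp: bounded_borel_on_def)
  then show thesis by (intro that[of "max 0 B"]) (auto simp: le_max_iff_disj)
qed

lemma bounded_borel_on_measurable [measurable_dest]:
  "f \<in> bounded_borel_on K \<Longrightarrow> f \<in> borel_measurable borel"
  by (simp add: bounded_borel_on_def)

lemma bounded_borel_on_const [simp, intro]: "(\<lambda>t. c) \<in> bounded_borel_on K"
  by (rule bounded_borel_onI[where B = "\<bar>c\<bar>"]) auto

lemma bounded_borel_on_indicator [simp, intro]:
  "S \<in> sets borel \<Longrightarrow> indicator S \<in> bounded_borel_on K"
  by (rule bounded_borel_onI[where B = 1]) (auto simp: indicator_def)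

lemma bounded_borel_on_continuous:
  assumes "compact K" "continuous_on UNIV f"
  shows "f \<in> bounded_borel_on K"
proof -
  have "bounded (f ` K)"
    using assms by (intro compact_imp_bounded compact_continuous_image continuous_on_subset[OF assms(2)]) auto
  then show ?thesis
    using assms(2) by (auto simp: bounded_borel_on_def bounded_real intro!: borel_measurable_continuous_onI)
qed

lemma bounded_borel_on_add [intro]:
  assumes "f \<in> bounded_borel_on K" "h \<in> bounded_borel_on K"
  shows "(\<lambda>t. f t + h t) \<in> bounded_borel_on K"
proof -
  from assms(1) obtain B where [measurable]: "f \<in> borel_measurable borel" and "0 \<le> B"
    and B [rule_format]: "\<forall>t\<in>K. \<bar>f t\<bar> \<le> B" by (rule bounded_borel_onE)
  from assms(2) obtain C where [measurable]: "h \<in> borel_measurable borel" and "0 \<le> C"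
    and C [rule_format]: "\<forall>t\<in>K. \<bar>h t\<bar> \<le> C" by (rule bounded_borel_onE)
  show ?thesis
    by (rule bounded_borel_onI[where B = "B + C"]) (use B C in \<open>auto intro: order_trans[OF abs_triangle_ineq] add_mono\<close>)
qed

lemma bounded_borel_on_mult [intro]:
  assumes "f \<in> bounded_borel_on K" "h \<in> bounded_borel_on K"
  shows "(\<lambda>t. f t * h t) \<in> bounded_borel_on K"
proof -
  from assms(1) obtain B where [measurable]: "f \<in> borel_measurable borel" and "0 \<le> B"
    and B [rule_format]: "\<forall>t\<in>K. \<bar>f t\<bar> \<le> B" by (rule bounded_borel_onE)
  from assms(2) obtain C where [measurable]: "h \<in> borel_measurable borel" and "0 \<le> C"
    and C [rule_format]: "\<forall>t\<in>K. \<bar>h t\<bar> \<le> C" by (rule bounded_borel_onE)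
  show ?thesis
    by (rule bounded_borel_onI[where B = "B * C"]) (use B C \<open>0 \<le> B\<close> in \<open>auto simp: abs_mult intro!: mult_mono\<close>)
qed

lemma bounded_borel_on_diff [intro]:
  assumes "f \<in> bounded_borel_on K" "h \<in> bounded_borel_on K"
  shows "(\<lambda>t. f t - h t) \<in> bounded_borel_on K"
  using bounded_borel_on_add[OF assms(1) bounded_borel_on_mult[OF bounded_borel_on_const[of "-1"] assms(2)]]
  by simp

text \<open>A finite signed measure carried by \<open>K\<close>, seen as a functional on bounded
  Borel functions; the last clause is bounded convergence. In this form differences of integrals
  need no Jordan decomposition. Convergence is required only on \<open>K\<close>, which is what
  encodes the support.\<close>

definition sigma_functional :: "real set \<Rightarrow> ((real \<Rightarrow> real) \<Rightarrow> real) \<Rightarrow> bool" where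
  "sigma_functional K \<Lambda> \<longleftrightarrow>
     (\<forall>f\<in>bounded_borel_on K. \<forall>h\<in>bounded_borel_on K. \<Lambda> (\<lambda>t. f t + h t) = \<Lambda> f + \<Lambda> h) \<and>
     (\<forall>c. \<forall>f\<in>bounded_borel_on K. \<Lambda> (\<lambda>t. c * f t) = c * \<Lambda> f) \<and>
     (\<forall>F f B. (\<forall>n::nat. F n \<in> borel_measurable borel) \<longrightarrow> f \<in> borel_measurable borel \<longrightarrow>
        (\<forall>n. \<forall>t\<in>K. \<bar>F n t\<bar> \<le> B) \<longrightarrow> (\<forall>t\<in>K. (\<lambda>n. F n t) \<longlonglongrightarrow> f t) \<longrightarrow>
        (\<lambda>n. \<Lambda> (F n)) \<longlonglongrightarrow> \<Lambda> f)"

lemma sigma_functional_add: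
  "sigma_functional K \<Lambda> \<Longrightarrow> f \<in> bounded_borel_on K \<Longrightarrow> h \<in> bounded_borel_on K \<Longrightarrow>
     \<Lambda> (\<lambda>t. f t + h t) = \<Lambda> f + \<Lambda> h"
  by (simp add: sigma_functional_def)

lemma sigma_functional_scale:
  "sigma_functional K \<Lambda> \<Longrightarrow> f \<in> bounded_borel_on K \<Longrightarrow> \<Lambda> (\<lambda>t. c * f t) = c * \<Lambda> f"
  by (simp add: sigma_functional_def)

lemma sigma_functional_tendsto:
  assumes "sigma_functional K \<Lambda>" "\<And>n::nat. F n \<in> borel_measurable borel"
    "f \<in> borel_measurable borel"
    "\<And>n t. t \<in> K \<Longrightarrow> \<bar>F n t\<bar> \<le> B" "\<And>t. t \<in> K \<Longrightarrow> (\<lambda>n. F n t) \<longlonglongrightarrow> f t"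
  shows "(\<lambda>n. \<Lambda> (F n)) \<longlonglongrightarrow> \<Lambda> f"
  using assms unfolding sigma_functional_def by blast

lemma sigma_functional_tendsto_zero:
  assumes "sigma_functional K \<Lambda>" "\<And>n::nat. F n \<in> borel_measurable borel"
    "f \<in> borel_measurable borel"
    "\<And>n t. t \<in> K \<Longrightarrow> \<bar>F n t\<bar> \<le> B" "\<And>t. t \<in> K \<Longrightarrow> (\<lambda>n. F n t) \<longlonglongrightarrow> f t"
    "\<And>n. \<Lambda> (F n) = 0"
  shows "\<Lambda> f = 0"
proof -
  have "(\<lambda>n. \<Lambda> (F n)) \<longlonglongrightarrow> \<Lambda> f" by (rule sigma_functional_tendsto[OF assms(1-5)])
  then have "(\<lambda>n::nat. 0) \<longlonglongrightarrow> \<Lambda> f" unfolding assms(6) .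
  then have "0 = \<Lambda> f" by (rule LIMSEQ_unique[OF tendsto_const])
  then show ?thesis by simp
qed

text \<open>The sequence constantly equal to \<open>f\<close> converges to \<open>h\<close>
  pointwise on \<open>K\<close>, so the continuity clause identifies the two values.\<close>

lemma sigma_functional_cong:
  assumes "sigma_functional K \<Lambda>" "f \<in> bounded_borel_on K" "h \<in> borel_measurable borel"
    "\<And>t. t \<in> K \<Longrightarrow> f t = h t"
  shows "\<Lambda> f = \<Lambda> h"
proof -
  from assms(2) obtain B where f: "f \<in> borel_measurable borel" and "0 \<le> B"
    and B [rule_format]: "\<forall>t\<in>K. \<bar>f t\<bar> \<le> B" by (rule bounded_borel_onE)
  have "(\<lambda>n::nat. \<Lambda> f) \<longlonglongrightarrow> \<Lambda> h"
    by (rule sigma_functional_tendsto[OF assms(1) f assms(3)]) (use assms(4) B in auto)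
  then show ?thesis by (simp add: LIMSEQ_const_iff)
qed

lemma sigma_functional_zero: "sigma_functional K \<Lambda> \<Longrightarrow> \<Lambda> (\<lambda>t. 0) = 0"
  using sigma_functional_scale[of K \<Lambda> "\<lambda>t. 0" 0] by simp

lemma sigma_functional_diff:
  assumes "sigma_functional K \<Lambda>" "f \<in> bounded_borel_on K" "h \<in> bounded_borel_on K"
  shows "\<Lambda> (\<lambda>t. f t - h t) = \<Lambda> f - \<Lambda> h"
  using sigma_functional_add[OF assms(1) bounded_borel_on_diff[OF assms(2,3)] assms(3)] by simp

lemma sigma_functional_sum:
  assumes "sigma_functional K \<Lambda>" "\<And>i. i \<in> I \<Longrightarrow> F i \<in> bounded_borel_on K"
  shows "\<Lambda> (\<lambda>t. \<Sum>i\<in>I. F i t) = (\<Sum>i\<in>I. \<Lambda> (F i))"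
proof -
  have "(\<lambda>t. \<Sum>i\<in>I. F i t) \<in> bounded_borel_on K \<and> \<Lambda> (\<lambda>t. \<Sum>i\<in>I. F i t) = (\<Sum>i\<in>I. \<Lambda> (F i))"
    using assms(2)
    by (induction I rule: infinite_finite_induct)
      (auto simp: sigma_functional_zero[OF assms(1)] sigma_functional_add[OF assms(1)])
  then show ?thesis by blast
qed

lemma sigma_functional_lincomb:
  assumes "sigma_functional K \<Lambda>" "sigma_functional K \<Lambda>'"
  shows "sigma_functional K (\<lambda>f. c * \<Lambda> f + d * \<Lambda>' f)"
  unfolding sigma_functional_def
proof (intro conjI ballI allI impI)
  fix F and f :: "real \<Rightarrow> real" and B assume *: "\<forall>n::nat. F n \<in> borel_measurable borel" "f \<in> borel_measurable borel"
    "\<forall>n. \<forall>t\<in>K. \<bar>F n t\<bar> \<le> B" "\<forall>t\<in>K. (\<lambda>n. F n t) \<longlonglongrightarrow> f t"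
  show "(\<lambda>n. c * \<Lambda> (F n) + d * \<Lambda>' (F n)) \<longlonglongrightarrow> c * \<Lambda> f + d * \<Lambda>' f"
    by (intro tendsto_intros sigma_functional_tendsto[OF assms(1), where B = B]
        sigma_functional_tendsto[OF assms(2), where B = B]) (use * in auto)
qed (simp_all add: sigma_functional_add[OF assms(1)] sigma_functional_add[OF assms(2)]
    sigma_functional_scale[OF assms(1)] sigma_functional_scale[OF assms(2)] algebra_simps)

text \<open>The signed measure with density \<open>w\<close>. It makes the two sides of a
  multiplicativity claim comparable as functionals of the other factor.\<close>

lemma sigma_functional_weight:
  assumes \<Lambda>: "sigma_functional K \<Lambda>" and w: "w \<in> bounded_borel_on K"
  shows "sigma_functional K (\<lambda>f. \<Lambda> (\<lambda>t. w t * f t))"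
  unfolding sigma_functional_def
proof (intro conjI ballI allI impI)
  from w obtain C where [measurable]: "w \<in> borel_measurable borel" and "0 \<le> C"
    and C [rule_format]: "\<forall>t\<in>K. \<bar>w t\<bar> \<le> C" by (rule bounded_borel_onE)
  fix F and f :: "real \<Rightarrow> real" and B assume *: "\<forall>n::nat. F n \<in> borel_measurable borel" "f \<in> borel_measurable borel"
    "\<forall>n. \<forall>t\<in>K. \<bar>F n t\<bar> \<le> B" "\<forall>t\<in>K. (\<lambda>n. F n t) \<longlonglongrightarrow> f t"
  note [measurable] = *(1)[rule_format] *(2)
  show "(\<lambda>n. \<Lambda> (\<lambda>t. w t * F n t)) \<longlonglongrightarrow> \<Lambda> (\<lambda>t. w t * f t)"
  proof (rule sigma_functional_tendsto[OF \<Lambda>, where B = "C * B"])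
    show "\<bar>w t * F n t\<bar> \<le> C * B" if "t \<in> K" for n t
      using that * C \<open>0 \<le> C\<close> by (auto simp: abs_mult intro!: mult_mono)
    show "(\<lambda>n. w t * F n t) \<longlonglongrightarrow> w t * f t" if "t \<in> K" for t
      using that * by (intro tendsto_intros) auto
  qed simp_all
next
  fix f h assume "f \<in> bounded_borel_on K" "h \<in> bounded_borel_on K"
  then show "\<Lambda> (\<lambda>t. w t * (f t + h t)) = \<Lambda> (\<lambda>t. w t * f t) + \<Lambda> (\<lambda>t. w t * h t)"
    using w sigma_functional_add[OF \<Lambda>, of "\<lambda>t. w t * f t" "\<lambda>t. w t * h t"] by (auto simp: distrib_left)
next
  fix c f assume "f \<in> bounded_borel_on K"
  then show "\<Lambda> (\<lambda>t. w t * (c * f t)) = c * \<Lambda> (\<lambda>t. w t * f t)"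
    using w sigma_functional_scale[OF \<Lambda>, of "\<lambda>t. w t * f t" c] by (auto simp: mult_ac)
qed

lemma integrable_bounded_borel_on:
  assumes "finite_measure M" "sets M = sets borel" "AE t in M. t \<in> K" "f \<in> bounded_borel_on K"
  shows "integrable M f"
proof -
  from assms(4) obtain B where f: "f \<in> borel_measurable borel" and "0 \<le> B"
    and B [rule_format]: "\<forall>t\<in>K. \<bar>f t\<bar> \<le> B" by (rule bounded_borel_onE)
  have "f \<in> borel_measurable M" using f assms(2) by (simp cong: measurable_cong_sets)
  moreover have "AE t in M. norm (f t) \<le> B" using assms(3) by eventually_elim (use B in auto)
  ultimately show ?thesis by (rule finite_measure.integrable_const_bound[OF assms(1), rotated])
qed

lemma sigma_functional_integral:
  assumes "finite_measure M" "sets M = sets borel" "AE t in M. t \<in> K"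
  shows "sigma_functional K (\<lambda>f. LINT t|M. f t)"
  unfolding sigma_functional_def
proof (intro conjI ballI allI impI)
  interpret finite_measure M by fact
  fix F and f :: "real \<Rightarrow> real" and B assume *: "\<forall>n::nat. F n \<in> borel_measurable borel" "f \<in> borel_measurable borel"
    "\<forall>n. \<forall>t\<in>K. \<bar>F n t\<bar> \<le> B" "\<forall>t\<in>K. (\<lambda>n. F n t) \<longlonglongrightarrow> f t"
  show "(\<lambda>n. LINT t|M. F n t) \<longlonglongrightarrow> (LINT t|M. f t)"
  proof (rule integral_dominated_convergence[where w = "\<lambda>t. B"])
    show "AE t in M. (\<lambda>n. F n t) \<longlonglongrightarrow> f t" using assms(3) by eventually_elim (use * in auto)
    show "AE t in M. norm (F n t) \<le> B" for n using assms(3) by eventually_elim (use * in auto)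
  qed (use * in \<open>simp_all add: measurable_cong_sets[OF assms(2) refl]\<close>)
qed (use integrable_bounded_borel_on[OF assms] in auto)

text \<open>Nonnegative Borel functions are built from indicators by scaling, sums and monotone
  limits, but the functions met on the way may be unbounded on \<open>K\<close>. Hence the claim of
  the induction is conditional on an upper bound on \<open>K\<close>, which nonnegativity passes on
  to summands and to the members of an increasing sequence.\<close>

lemma sigma_functional_eq_zero_indicator:
  assumes \<Lambda>: "sigma_functional K \<Lambda>" and f: "f \<in> bounded_borel_on K"
    and ind: "\<And>S. S \<in> sets borel \<Longrightarrow> \<Lambda> (indicator S) = 0"
  shows "\<Lambda> f = 0"
proof -
  from f obtain B where f': "f \<in> borel_measurable borel" and "0 \<le> B"
    and B [rule_format]: "\<forall>t\<in>K. \<bar>f t\<bar> \<le> B" by (rule bounded_borel_onE)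
  have nonneg: "(\<exists>C. \<forall>t\<in>K. u t \<le> C) \<longrightarrow> \<Lambda> u = 0"
    if "u \<in> borel_measurable borel" "\<And>t. 0 \<le> u t" for u
    using that
  proof (induction u rule: borel_measurable_induct_real)
    case (set S)
    then show ?case by (simp add: ind)
  next
    case (mult u c)
    show ?case
    \<comment> \<open>For \<open>c = 0\<close> a bound on \<open>c * u\<close> says nothing about
      \<open>u\<close>.\<close>
    proof (cases "c = 0")
      case True
      then show ?thesis by (simp add: sigma_functional_zero[OF \<Lambda>])
    next
      case False
      show ?thesis
      proof
        assume "\<exists>C. \<forall>t\<in>K. c * u t \<le> C"
        then obtain C where "\<forall>t\<in>K. c * u t \<le> C" ..
        then have C: "\<forall>t\<in>K. u t \<le> C / c" using False mult(1) by (auto simp: field_simps)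
        then have "u \<in> bounded_borel_on K"
          using mult by (intro bounded_borel_onI[of _ _ "C / c"]) auto
        then show "\<Lambda> (\<lambda>t. c * u t) = 0"
          using sigma_functional_scale[OF \<Lambda>, of u c] C mult by auto
      qed
    qed
  next
    case (add u v)
    show ?case
    proof
      assume "\<exists>C. \<forall>t\<in>K. v t + u t \<le> C"
      then obtain C where C: "\<forall>t\<in>K. v t + u t \<le> C" ..
      have le: "u t \<le> C \<and> v t \<le> C" if "t \<in> K" for t
      proof -
        have "v t + u t \<le> C" "0 \<le> u t" "0 \<le> v t" using C that add by auto
        then show ?thesis by linarith
      qed
      then have "\<exists>C. \<forall>t\<in>K. u t \<le> C" "\<exists>C. \<forall>t\<in>K. v t \<le> C" by blast+
      then have "\<Lambda> u = 0" "\<Lambda> v = 0" using add by blast+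
      moreover have "u \<in> bounded_borel_on K" "v \<in> bounded_borel_on K"
        by (rule bounded_borel_onI[where B = C]; use add le in simp)+
      ultimately show "\<Lambda> (\<lambda>t. v t + u t) = 0"
        by (simp add: sigma_functional_add[OF \<Lambda>])
    qed
  next
    case (seq U)
    have U0: "0 \<le> U n t" and lim: "(\<lambda>n. U n t) \<longlonglongrightarrow> u t" for n t
      using seq by (blast, simp)
    have "incseq (\<lambda>n. U n t)" for t using \<open>incseq U\<close> by (auto simp: incseq_def le_fun_def)
    then have le: "U n t \<le> u t" for n t using lim by (rule incseq_le)
    show ?case
    proof
      assume "\<exists>C. \<forall>t\<in>K. u t \<le> C"
      then obtain C where C: "\<forall>t\<in>K. u t \<le> C" ..
      have U: "U n t \<le> C" if "t \<in> K" for n t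
        using le[of n t] bspec[OF C that] by linarith
      show "\<Lambda> u = 0"
      proof (rule sigma_functional_tendsto_zero[OF \<Lambda>, where F = U and B = C])
        show "\<Lambda> (U n) = 0" for n using seq U by blast
        show "\<bar>U n t\<bar> \<le> C" if "t \<in> K" for n t using U[OF that] U0 by simp
        show "U n \<in> borel_measurable borel" for n using seq by blast
        show "u \<in> borel_measurable borel" by fact
      qed (rule lim)
    qed
  qed
  \<comment> \<open>Shifting by \<open>B\<close> makes \<open>f\<close> nonnegative on
    \<open>K\<close> only; the maximum does so off \<open>K\<close>, where the values do not affect
    \<open>\<Lambda>\<close>.\<close>
  define u where "u t = max 0 (f t + B)" for t
  have [measurable]: "u \<in> borel_measurable borel" using f' unfolding u_def by measurable
  have u: "u t = f t + B" if "t \<in> K" for t using B[OF that] by (auto simp: u_def)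
  have "\<Lambda> u = 0"
  proof (rule nonneg[THEN mp])
    show "\<exists>C. \<forall>t\<in>K. u t \<le> C" using u B by (intro exI[of _ "2 * B"]) fastforce
  qed (auto simp: u_def)
  moreover have "\<Lambda> (\<lambda>t. B) = 0"
    using sigma_functional_scale[OF \<Lambda>, of "indicator UNIV" B] ind[of UNIV] by simp
  moreover have "\<Lambda> (\<lambda>t. f t + B) = \<Lambda> u"
    by (rule sigma_functional_cong[OF \<Lambda>]) (use u f in auto)
  ultimately show ?thesis using sigma_functional_add[OF \<Lambda> f, of "\<lambda>t. B"] by simp
qed

text \<open>Weierstrass approximation on \<open>K\<close> extends the vanishing from polynomials to
  continuous functions, pointwise limits of these give the half-lines \<open>{..a}\<close>, and
  half-lines are an intersection-stable generator of the Borel sets, so Dynkin's theorem reaches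
  every indicator.\<close>

lemma sigma_functional_eq_zero_power:
  assumes K: "compact K" and \<Lambda>: "sigma_functional K \<Lambda>" and f: "f \<in> bounded_borel_on K"
    and pow: "\<And>k. \<Lambda> (\<lambda>t. t ^ k) = 0"
  shows "\<Lambda> f = 0"
proof (rule sigma_functional_eq_zero_indicator[OF \<Lambda> f])
  have powbb: "(\<lambda>t. t ^ k) \<in> bounded_borel_on K" for k
    by (rule bounded_borel_on_continuous[OF K]) (intro continuous_intros)
  have poly: "\<Lambda> p = 0" if p: "real_polynomial_function p" for p :: "real \<Rightarrow> real"
  proof -
    obtain a n where "p = (\<lambda>t. \<Sum>i\<le>n. a i * t ^ i)"
      using p unfolding real_polynomial_function_iff_sum by blast
    then show ?thesis
      using powbb by (simp add: sigma_functional_sum[OF \<Lambda>] sigma_functional_scale[OF \<Lambda>] pow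
          bounded_borel_on_mult)
  qed
  have cont: "\<Lambda> h = 0" if h: "continuous_on UNIV h" for h
  proof -
    have "\<exists>p. real_polynomial_function p \<and> (\<forall>t\<in>K. \<bar>h t - p t\<bar> < inverse (real (Suc n)))" for n
      by (rule Stone_Weierstrass_real_polynomial_function[OF K continuous_on_subset[OF h], of "inverse (real (Suc n))"])
        auto
    then obtain p where p: "\<And>n. real_polynomial_function (p n)"
      and hp: "\<And>n t. t \<in> K \<Longrightarrow> \<bar>h t - p n t\<bar> < inverse (real (Suc n))" by metis
    from bounded_borel_on_continuous[OF K h] obtain B where
      "h \<in> borel_measurable borel" "0 \<le> B" and
      B [rule_format]: "\<forall>t\<in>K. \<bar>h t\<bar> \<le> B" by (rule bounded_borel_onE)
    show ?thesis
    proof (rule sigma_functional_tendsto_zero[OF \<Lambda>, where F = p and B = "B + 1"])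
      show "p n \<in> borel_measurable borel" for n
        using p by (intro borel_measurable_continuous_onI continuous_on_polymonial_function)
          (simp add: real_polynomial_function_eq)
      show "h \<in> borel_measurable borel" using h by (rule borel_measurable_continuous_onI)
      show "\<bar>p n t\<bar> \<le> B + 1" if "t \<in> K" for n t
      proof -
        have "inverse (real (Suc n)) \<le> 1" by (simp add: inverse_le_1_iff)
        then show ?thesis using hp[OF that, of n] B[OF that] by linarith
      qed
      show "(\<lambda>n. p n t) \<longlonglongrightarrow> h t" if "t \<in> K" for t
      proof (rule LIM_zero_cancel, rule Lim_null_comparison[OF _ LIMSEQ_inverse_real_of_nat])
        show "\<forall>\<^sub>F n in sequentially. norm (p n t - h t) \<le> inverse (real (Suc n))"
          using hp[OF that] by (intro always_eventually) (auto simp: abs_minus_commute intro: less_imp_le)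
      qed
      show "\<Lambda> (p n) = 0" for n by (rule poly[OF p])
    qed
  qed
  \<comment> \<open>For \<open>n > 0\<close> the approximants are 1 up to \<open>a\<close>, fall
    linearly with slope \<open>- n\<close>, and are 0 from \<open>a + 1 / n\<close> on.\<close>
  have atMost: "\<Lambda> (indicator {..a}) = 0" for a
  proof (rule sigma_functional_tendsto_zero[OF \<Lambda>,
        where F = "\<lambda>n t. max 0 (min 1 (1 - real n * (t - a)))" and B = 1])
    show "\<Lambda> (\<lambda>t. max 0 (min 1 (1 - real n * (t - a)))) = 0" for n
      by (rule cont) (intro continuous_intros)
    show "(\<lambda>n. max 0 (min 1 (1 - real n * (t - a)))) \<longlonglongrightarrow> indicator {..a} t" for t
    proof (cases "t \<le> a")
      case True
      then have "max 0 (min 1 (1 - real n * (t - a))) = 1" for n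
        by (simp add: min_def max_def mult_nonneg_nonpos)
      then show ?thesis using True by simp
    next
      case False
      obtain N where N: "1 / (t - a) < real N" using reals_Archimedean2 by blast
      have "max 0 (min 1 (1 - real n * (t - a))) = 0" if "n \<ge> N" for n
      proof -
        have "1 / (t - a) < real n" using N that by linarith
        then have "1 < real n * (t - a)" using False by (simp add: field_simps)
        then show ?thesis by simp
      qed
      then have "\<forall>\<^sub>F n in sequentially. max 0 (min 1 (1 - real n * (t - a))) = 0"
        by (auto simp: eventually_sequentially)
      then show ?thesis using False by (simp add: tendsto_eventually)
    qed
  qed (auto intro!: borel_measurable_continuous_onI continuous_intros)
  fix S :: "real set" assume S: "S \<in> sets borel"
  have gen: "sets borel = sigma_sets UNIV (range (\<lambda>a::real. {..a}))"
    by (subst borel_eq_atMost) simp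
  have "Int_stable (range (\<lambda>a::real. {..a}))"
    by (auto simp: Int_stable_def)
  moreover have "range (\<lambda>a::real. {..a}) \<subseteq> Pow UNIV" by simp
  moreover have "S \<in> sigma_sets UNIV (range (\<lambda>a::real. {..a}))" using S gen by simp
  ultimately show "\<Lambda> (indicator S) = 0"
  proof (induction S rule: sigma_sets_induct_disjoint)
    case (basic A)
    then show ?case using atMost by auto
  next
    case empty
    then show ?case using sigma_functional_zero[OF \<Lambda>] by (simp add: indicator_def)
  next
    case (compl A)
    then have A: "A \<in> sets borel" using gen by simp
    \<comment> \<open>The moment of order 0 is the total mass, which settles complements.\<close>
    have "\<Lambda> (\<lambda>t. 1) = 0" using pow[of 0] by simp
    moreover have "indicator (UNIV - A) = (\<lambda>t. 1 - indicator A t :: real)"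
      by (auto simp: indicator_def)
    ultimately show ?case
      using sigma_functional_diff[OF \<Lambda>, of "\<lambda>t. 1" "indicator A"] compl A by simp
  next
    case (union F)
    then have F: "F i \<in> sets borel" for i using gen by auto
    show ?case
    proof (rule sigma_functional_tendsto_zero[OF \<Lambda>, where F = "\<lambda>n t. \<Sum>i<n. indicator (F i) t" and B = 1])
      have eq: "(\<Sum>i<n. indicator (F i) t) = (indicator (\<Union>i<n. F i) t :: real)" for n t
        by (rule indicator_UN_disjoint[symmetric])
          (use union(1) in \<open>auto simp: disjoint_family_on_def\<close>)
      show "\<bar>\<Sum>i<n. indicator (F i) t\<bar> \<le> (1::real)" for n t unfolding eq by (auto simp: indicator_def)
      show "(\<lambda>n. \<Sum>i<n. indicator (F i) t) \<longlonglongrightarrow> (indicator (\<Union>i. F i) t :: real)" for t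
        unfolding eq by (rule LIMSEQ_indicator_UN)
      show "\<Lambda> (\<lambda>t. \<Sum>i<n. indicator (F i) t) = 0" for n
        using F union by (subst sigma_functional_sum[OF \<Lambda>]) auto
    qed (use F in auto)
  qed
qed

section \<open>Functional calculus of a family of measures\<close>

text \<open>Common core of two situations: monomials \<open>d k\<close> with the powers
  \<open>P k\<close> of an operator and measures from the moment problem, and indicators
  \<open>d S\<close> with the projections \<open>P S\<close> of a projection-valued measure.
  \<open>P_form\<close> ties measures to operators on the diagonal only; \<open>determining\<close>
  and \<open>P_mult\<close> suffice to recover the rest.\<close>

locale spectral_calculus =
  fixes m :: "'a::{real_inner, complete_space} \<Rightarrow> real measure" and K :: "real set"
    and I :: "'i set" and d :: "'i \<Rightarrow> real \<Rightarrow> real" and P :: "'i \<Rightarrow> 'a \<Rightarrow> 'a"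
  assumes m_finite: "finite_measure (m x)"
    and m_sets: "sets (m x) = sets borel"
    and m_supp: "AE t in m x. t \<in> K"
    and d_bb: "i \<in> I \<Longrightarrow> d i \<in> bounded_borel_on K"
    and determining: "\<And>\<Lambda> f. sigma_functional K \<Lambda> \<Longrightarrow> (\<And>i. i \<in> I \<Longrightarrow> \<Lambda> (d i) = 0) \<Longrightarrow>
        f \<in> bounded_borel_on K \<Longrightarrow> \<Lambda> f = 0"
    and P_linear: "i \<in> I \<Longrightarrow> bounded_linear (P i)"
    and P_selfadjoint: "i \<in> I \<Longrightarrow> selfadjoint (P i)"
    and P_form: "i \<in> I \<Longrightarrow> P i x \<bullet> x = (LINT t|m x. d i t)"
    and P_mult: "i \<in> I \<Longrightarrow> j \<in> I \<Longrightarrow> \<exists>k\<in>I. d k = (\<lambda>t. d i t * d j t) \<and> P k = P i \<circ> P j"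
    and P_one: "\<exists>i\<in>I. d i = (\<lambda>t. 1) \<and> P i = id"
begin

lemma sigma_functional_eqI:
  assumes "sigma_functional K \<Lambda>" "sigma_functional K \<Lambda>'"
    "\<And>i. i \<in> I \<Longrightarrow> \<Lambda> (d i) = \<Lambda>' (d i)" "f \<in> bounded_borel_on K"
  shows "\<Lambda> f = \<Lambda>' f"
  using determining[OF sigma_functional_lincomb[OF assms(1,2), of 1 "-1"] _ assms(4)] assms(3)
  by simp

text \<open>By polarization, the integral of \<open>f\<close> against the signed measure that
  belongs to the pair \<open>x\<close>, \<open>y\<close>. The coefficient \<open>-1/4\<close> is
  added instead of subtracted to fit \<open>sigma_functional_lincomb\<close>.\<close>

definition pairing :: "'a \<Rightarrow> 'a \<Rightarrow> (real \<Rightarrow> real) \<Rightarrow> real" where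
  "pairing x y f = 1/4 * (LINT t|m (x + y). f t) + -1/4 * (LINT t|m (x - y). f t)"

lemmas sigma_functional_m = sigma_functional_integral[OF m_finite m_sets m_supp]

lemma sigma_functional_pairing: "sigma_functional K (pairing x y)"
  unfolding pairing_def by (intro sigma_functional_lincomb sigma_functional_m)

lemma pairing_d: "i \<in> I \<Longrightarrow> pairing x y (d i) = P i x \<bullet> y"
  unfolding inner_polarization[OF P_linear P_selfadjoint, of i x y] P_form
  by (simp add: pairing_def)

text \<open>Nothing relates \<open>m (x + x' + y)\<close> to the other measures directly. Both sides
  are sigma functionals in \<open>f\<close>, and on each \<open>d i\<close> they agree because
  \<open>P i\<close> is linear. Scaling, symmetry and the diagonal are obtained in the same
  way.\<close>

lemma pairing_add_left:
  "f \<in> bounded_borel_on K \<Longrightarrow> pairing (x + x') y f = pairing x y f + pairing x' y f"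
  using sigma_functional_eqI[OF sigma_functional_pairing[of "x + x'" y]
      sigma_functional_lincomb[OF sigma_functional_pairing[of x y] sigma_functional_pairing[of x' y], of 1 1], of f]
  by (simp add: pairing_d linear_add[OF bounded_linear.linear[OF P_linear]] inner_add_left)

lemma pairing_scale_left:
  "f \<in> bounded_borel_on K \<Longrightarrow> pairing (c *\<^sub>R x) y f = c * pairing x y f"
  using sigma_functional_eqI[OF sigma_functional_pairing[of "c *\<^sub>R x" y]
      sigma_functional_lincomb[OF sigma_functional_pairing[of x y] sigma_functional_pairing[of x y], of c 0], of f]
  by (simp add: pairing_d linear_scale[OF bounded_linear.linear[OF P_linear]])

lemma pairing_commute: "f \<in> bounded_borel_on K \<Longrightarrow> pairing x y f = pairing y x f"
  by (rule sigma_functional_eqI[OF sigma_functional_pairing sigma_functional_pairing])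
    (use P_selfadjoint in \<open>auto simp: pairing_d selfadjoint_def inner_commute\<close>)

lemma pairing_self: "f \<in> bounded_borel_on K \<Longrightarrow> pairing x x f = (LINT t|m x. f t)"
  by (rule sigma_functional_eqI[OF sigma_functional_pairing sigma_functional_m])
    (auto simp: pairing_d P_form)

lemma integral_m_const: "(LINT t|m x. c) = c * (norm x)\<^sup>2"
proof -
  obtain i where "i \<in> I" "d i = (\<lambda>t. 1)" "P i = id" using P_one by blast
  then have "(LINT t|m x. 1) = (norm x)\<^sup>2" using P_form[of i x] by (simp add: power2_norm_eq_inner)
  then show ?thesis by (simp add: mult.commute)
qed

lemma integral_m_bound:
  assumes f: "f \<in> bounded_borel_on K" and B: "\<forall>t\<in>K. \<bar>f t\<bar> \<le> B"
  shows "\<bar>LINT t|m x. f t\<bar> \<le> B * (norm x)\<^sup>2"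
proof -
  have "\<bar>LINT t|m x. f t\<bar> \<le> (LINT t|m x. \<bar>f t\<bar>)" by (rule integral_abs_bound)
  also have "\<dots> \<le> (LINT t|m x. B)"
  proof (rule integral_mono_AE)
    show "AE t in m x. \<bar>f t\<bar> \<le> B" using m_supp[of x] by eventually_elim (use B in auto)
  qed (intro integrable_abs integrable_bounded_borel_on[OF m_finite m_sets m_supp] f bounded_borel_on_const)+
  finally show ?thesis by (simp only: integral_m_const)
qed

text \<open>Polarization and the parallelogram law first give the bound with
  \<open>((norm x)\<^sup>2 + (norm y)\<^sup>2) / 2\<close>; applied to normalized vectors it becomes
  a product by homogeneity.\<close>

lemma pairing_bound:
  assumes f: "f \<in> bounded_borel_on K" and B: "\<forall>t\<in>K. \<bar>f t\<bar> \<le> B"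
  shows "\<bar>pairing x y f\<bar> \<le> B * norm x * norm y"
proof -
  have *: "\<bar>pairing x y f\<bar> \<le> B / 2 * ((norm x)\<^sup>2 + (norm y)\<^sup>2)" for x y
  proof -
    have "\<bar>pairing x y f\<bar> \<le> 1/4 * (B * (norm (x + y))\<^sup>2) + 1/4 * (B * (norm (x - y))\<^sup>2)"
      using integral_m_bound[OF f B, of "x + y"] integral_m_bound[OF f B, of "x - y"]
      unfolding pairing_def by argo
    also have "\<dots> = B / 2 * ((norm x)\<^sup>2 + (norm y)\<^sup>2)"
      by (simp add: power2_norm_eq_inner inner_simps inner_commute field_simps)
    finally show ?thesis .
  qed
  have right: "pairing x (c *\<^sub>R y) f = c * pairing x y f" for x y c
    using pairing_scale_left[OF f, of c y x] pairing_commute[OF f, of x] by metis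
  show ?thesis
  proof (cases "x = 0 \<or> y = 0")
    case True
    then show ?thesis
      using pairing_scale_left[OF f, of 0 x y] right[of x 0 y] by auto
  next
    case False
    have eq: "pairing x y f = norm x * norm y * pairing (inverse (norm x) *\<^sub>R x) (inverse (norm y) *\<^sub>R y) f"
      using False by (simp add: pairing_scale_left[OF f] right field_simps)
    have "\<bar>pairing (inverse (norm x) *\<^sub>R x) (inverse (norm y) *\<^sub>R y) f\<bar> \<le> B"
      using *[of "inverse (norm x) *\<^sub>R x" "inverse (norm y) *\<^sub>R y"] False by simp
    then have "norm x * norm y * \<bar>pairing (inverse (norm x) *\<^sub>R x) (inverse (norm y) *\<^sub>R y) f\<bar>
        \<le> norm x * norm y * B"
      by (rule mult_left_mono) simp
    then show ?thesis
      by (subst eq) (simp add: abs_mult mult_ac)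
  qed
qed

text \<open>The Riesz vector of the functional \<open>y \<mapsto> pairing x y f\<close>, which is
  bounded when \<open>f\<close> is in \<open>bounded_borel_on K\<close>.\<close>

definition Op :: "(real \<Rightarrow> real) \<Rightarrow> 'a \<Rightarrow> 'a" where
  "Op f x = (SOME z. \<forall>y. pairing x y f = z \<bullet> y)"

lemma inner_Op:
  assumes f: "f \<in> bounded_borel_on K"
  shows "Op f x \<bullet> y = pairing x y f"
proof -
  obtain B where B: "0 \<le> B" "\<forall>t\<in>K. \<bar>f t\<bar> \<le> B" using f by (rule bounded_borel_onE)
  have "bounded_linear (\<lambda>y. pairing x y f)"
  proof (rule bounded_linear_intro)
    show "pairing x (y + y') f = pairing x y f + pairing x y' f" for y y'
      using pairing_add_left[OF f, of y y' x] pairing_commute[OF f, of x] by metis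
    show "pairing x (c *\<^sub>R y) f = c *\<^sub>R pairing x y f" for c y
      using pairing_scale_left[OF f, of c y x] pairing_commute[OF f, of x] by (metis real_scaleR_def)
    show "norm (pairing x y f) \<le> norm y * (B * norm x)" for y
      using pairing_bound[OF f, of B x y] B by (simp add: mult_ac)
  qed
  then have "\<exists>z. \<forall>y. pairing x y f = z \<bullet> y" by (rule riesz_representation)
  then have "\<forall>y. pairing x y f = Op f x \<bullet> y" unfolding Op_def by (rule someI_ex)
  then show ?thesis by simp
qed

lemma bounded_linear_Op:
  assumes f: "f \<in> bounded_borel_on K"
  shows "bounded_linear (Op f)"
proof -
  obtain B where B: "0 \<le> B" "\<forall>t\<in>K. \<bar>f t\<bar> \<le> B" using f by (rule bounded_borel_onE)
  show ?thesis
    by (rule bounded_linear_form[OF inner_Op[OF f], where K = B])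
      (use B pairing_bound[OF f] in \<open>auto simp: pairing_add_left[OF f] pairing_scale_left[OF f]\<close>)
qed

lemma selfadjoint_Op: "f \<in> bounded_borel_on K \<Longrightarrow> selfadjoint (Op f)"
  unfolding selfadjoint_def using inner_Op pairing_commute inner_commute by metis

lemma Op_form: "f \<in> bounded_borel_on K \<Longrightarrow> Op f x \<bullet> x = (LINT t|m x. f t)"
  by (simp add: inner_Op pairing_self)

lemma Op_eqI:
  assumes "f \<in> bounded_borel_on K" "bounded_linear G" "selfadjoint G"
    "\<And>x. G x \<bullet> x = (LINT t|m x. f t)"
  shows "Op f = G"
  using assms by (intro selfadjoint_eqI bounded_linear_Op selfadjoint_Op) (auto simp: Op_form)

lemma Op_d: "i \<in> I \<Longrightarrow> Op (d i) = P i"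
  by (intro Op_eqI d_bb P_linear P_selfadjoint P_form)

lemma Op_cong:
  assumes "f \<in> bounded_borel_on K" "h \<in> bounded_borel_on K" "\<And>t. t \<in> K \<Longrightarrow> f t = h t"
  shows "Op f = Op h"
proof
  fix x
  show "Op f x = Op h x"
    by (rule eq_if_inner_eq) (use assms sigma_functional_cong[OF sigma_functional_pairing, of f h] in
        \<open>auto simp: inner_Op\<close>)
qed

lemma Op_add:
  assumes "f \<in> bounded_borel_on K" "h \<in> bounded_borel_on K"
  shows "Op (\<lambda>t. f t + h t) x = Op f x + Op h x"
  by (rule eq_if_inner_eq) (use assms in
      \<open>simp add: inner_Op bounded_borel_on_add sigma_functional_add[OF sigma_functional_pairing] inner_add_left\<close>)

lemma Op_diff:
  assumes "f \<in> bounded_borel_on K" "h \<in> bounded_borel_on K"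
  shows "Op (\<lambda>t. f t - h t) x = Op f x - Op h x"
  using Op_add[OF bounded_borel_on_diff[OF assms] assms(2)] by simp

text \<open>Applying \<open>P i\<close> to \<open>x\<close> multiplies the signed measure by the
  density \<open>d i\<close>; on a determining function \<open>d j\<close> this is
  \<open>P_mult\<close>.\<close>

lemma pairing_P_left:
  assumes "i \<in> I" "f \<in> bounded_borel_on K"
  shows "pairing (P i x) y f = pairing x y (\<lambda>t. d i t * f t)"
proof (rule sigma_functional_eqI[OF sigma_functional_pairing
      sigma_functional_weight[OF sigma_functional_pairing d_bb[OF assms(1)]] _ assms(2)])
  fix j assume j: "j \<in> I"
  then obtain k where "k \<in> I" "d k = (\<lambda>t. d j t * d i t)" "P k = P j \<circ> P i"
    using P_mult assms(1) by blast
  then show "pairing (P i x) y (d j) = pairing x y (\<lambda>t. d i t * d j t)"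
    using pairing_d[of k x y] pairing_d[OF j] by (simp add: mult.commute)
qed

text \<open>Multiplicativity passes from the determining functions to one factor first, which is
  \<open>pairing_P_left\<close>, and then to the other one.\<close>

lemma Op_mult:
  assumes f: "f \<in> bounded_borel_on K" and h: "h \<in> bounded_borel_on K"
  shows "Op f (Op h x) = Op (\<lambda>t. f t * h t) x"
proof (rule eq_if_inner_eq)
  fix y
  have fh: "(\<lambda>t. h t * f t) \<in> bounded_borel_on K" using f h by blast
  have "pairing (Op h x) y f = pairing x y (\<lambda>t. h t * f t)"
  proof (rule sigma_functional_eqI[OF sigma_functional_pairing
        sigma_functional_weight[OF sigma_functional_pairing h] _ f])
    fix j assume j: "j \<in> I"
    have "pairing (Op h x) y (d j) = Op h x \<bullet> P j y"
      using P_selfadjoint[OF j] by (simp add: pairing_d[OF j] selfadjoint_def)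
    also have "\<dots> = pairing (P j y) x h"
      by (simp add: inner_Op[OF h] pairing_commute[OF h])
    also have "\<dots> = pairing y x (\<lambda>t. d j t * h t)" by (rule pairing_P_left[OF j h])
    also have "\<dots> = pairing x y (\<lambda>t. h t * d j t)"
      using pairing_commute[OF bounded_borel_on_mult[OF h d_bb[OF j]], of x y]
      by (simp add: mult.commute)
    finally show "pairing (Op h x) y (d j) = pairing x y (\<lambda>t. h t * d j t)" .
  qed
  then show "Op f (Op h x) \<bullet> y = Op (\<lambda>t. f t * h t) x \<bullet> y"
    using inner_Op[OF f] inner_Op[OF fh] by (simp add: mult.commute)
qed

text \<open>Self-adjointness and multiplicativity turn the squared norm into an integral. Dominated
  convergence for functions thereby becomes strong convergence of operators, and sup bounds become
  norm bounds.\<close>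

lemma norm_Op: "f \<in> bounded_borel_on K \<Longrightarrow> (norm (Op f x))\<^sup>2 = (LINT t|m x. (f t)\<^sup>2)"
proof -
  assume f: "f \<in> bounded_borel_on K"
  have "(norm (Op f x))\<^sup>2 = Op f (Op f x) \<bullet> x"
    using selfadjoint_Op[OF f] by (simp add: power2_norm_eq_inner selfadjoint_def)
  also have "\<dots> = (LINT t|m x. (f t)\<^sup>2)"
    using f by (simp add: Op_mult Op_form bounded_borel_on_mult power2_eq_square)
  finally show ?thesis .
qed

lemma norm_Op_le:
  assumes f: "f \<in> bounded_borel_on K" and B: "\<forall>t\<in>K. \<bar>f t\<bar> \<le> B" and "0 \<le> B"
  shows "norm (Op f x) \<le> B * norm x"
proof (rule power2_le_imp_le)
  have "(norm (Op f x))\<^sup>2 \<le> \<bar>LINT t|m x. f t * f t\<bar>" unfolding norm_Op[OF f] by (simp add: power2_eq_square)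
  also have "\<dots> \<le> (B * B) * (norm x)\<^sup>2"
  proof (rule integral_m_bound)
    show "\<forall>t\<in>K. \<bar>f t * f t\<bar> \<le> B * B"
    proof
      fix t assume "t \<in> K"
      then have "\<bar>f t\<bar> * \<bar>f t\<bar> \<le> B * B" using B assms(3) by (intro mult_mono) auto
      then show "\<bar>f t * f t\<bar> \<le> B * B" by (simp only: abs_mult)
    qed
  qed (use f in blast)
  finally show "(norm (Op f x))\<^sup>2 \<le> (B * norm x)\<^sup>2" by (simp add: power2_eq_square mult_ac)
qed (use assms(3) in simp)

end

section \<open>The Hausdorff moment problem\<close>

text \<open>With \<open>v j l\<close> read as the integral of \<open>t ^ j * (1 - t) ^ l\<close>,
  the hypothesis is \<open>t + (1 - t) = 1\<close> and the claim is the binomial expansion of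
  \<open>(t + (1 - t)) ^ n\<close>.\<close>

lemma binomial_sum_difference_array:
  fixes v :: "nat \<Rightarrow> nat \<Rightarrow> real"
  assumes v: "\<And>j l. v j l = v (Suc j) l + v j (Suc l)"
  shows "(\<Sum>j\<le>n. real (n choose j) * v j (n - j)) = v 0 0"
proof (induction n)
  case (Suc n)
  \<comment> \<open>The entries on antidiagonal \<open>Suc n\<close>. Each entry on antidiagonal
    \<open>n\<close> is a sum of two neighbours there, and Pascal's rule collects them.\<close>
  define a where "a j = v j (Suc n - j)" for j
  have "(\<Sum>j\<le>n. real (n choose j) * v j (n - j)) = (\<Sum>j\<le>n. real (n choose j) * (a (Suc j) + a j))"
  proof (rule sum.cong[OF refl])
    fix j assume "j \<in> {..n}"
    then show "real (n choose j) * v j (n - j) = real (n choose j) * (a (Suc j) + a j)"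
      using v[of j "n - j"] by (simp add: a_def Suc_diff_le)
  qed
  also have "\<dots> = (\<Sum>j\<le>n. real (n choose j) * a (Suc j)) + (\<Sum>j\<le>Suc n. real (n choose j) * a j)"
    by (simp add: distrib_left sum.distrib)
  also have "\<dots> = (\<Sum>j\<le>Suc n. real (Suc n choose j) * a j)"
    unfolding sum.atMost_Suc_shift[of _ n] by (simp add: distrib_right sum.distrib)
  finally show ?case using Suc by (simp add: a_def)
qed simp

text \<open>In the same reading this is \<open>t ^ k * (t + (1 - t)) ^ (n - k)\<close>: the
  Bernstein sum reproduces the k-th moment exactly if the node value is
  \<open>(j choose k) / (n choose k)\<close> instead of \<open>(j / n) ^ k\<close>. After cancelling
  binomials it is the preceding lemma for the array shifted by \<open>k\<close>.\<close>

lemma binomial_moment_difference_array: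
  fixes v :: "nat \<Rightarrow> nat \<Rightarrow> real"
  assumes v: "\<And>j l. v j l = v (Suc j) l + v j (Suc l)" and "k \<le> n"
  shows "(\<Sum>j\<le>n. real (n choose j) * v j (n - j) * (real (j choose k) / real (n choose k))) = v k 0"
proof -
  let ?f = "\<lambda>j. real (n choose j) * v j (n - j) * (real (j choose k) / real (n choose k))"
  have nz: "real (n choose k) \<noteq> 0" using assms(2) by simp
  have "(\<Sum>j\<le>n. ?f j) = (\<Sum>j\<in>{k..n}. ?f j)"
    by (rule sum.mono_neutral_right) (auto simp: binomial_eq_0)
  also have "\<dots> = (\<Sum>j\<in>{k..n}. real (n - k choose (j - k)) * v j (n - j))"
  proof (rule sum.cong)
    fix j assume "j \<in> {k..n}"
    then have "real (n choose j) * real (j choose k) = real (n choose k) * real (n - k choose (j - k))"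
      using choose_mult[of k j n] by (metis atLeastAtMost_iff of_nat_mult)
    then show "?f j = real (n - k choose (j - k)) * v j (n - j)"
      using nz by (simp add: field_simps)
  qed simp
  also have "\<dots> = (\<Sum>i\<le>n - k. real (n - k choose i) * v (k + i) (n - k - i))"
    by (rule sum.reindex_bij_witness[of _ "\<lambda>i. k + i" "\<lambda>j. j - k"]) (use assms(2) in auto)
  also have "\<dots> = v k 0"
  proof (subst binomial_sum_difference_array[of "\<lambda>i. v (k + i)"])
    show "v (k + i) l = v (k + Suc i) l + v (k + i) (Suc l)" for i l
      using v[of "k + i" l] by simp
  qed simp
  finally show ?thesis .
qed

text \<open>The ratio is the product of the factors \<open>(j - i) / (n - i)\<close> for
  \<open>i < k\<close>, each within \<open>i / n\<close> of \<open>j / n\<close>; all factors lie in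
  the unit interval, so the errors add up.\<close>

lemma binomial_ratio_power_bound:
  assumes "j \<le> n" "k \<le> n" "0 < n"
  shows "\<bar>real (j choose k) / real (n choose k) - (real j / real n) ^ k\<bar> \<le> (real k)\<^sup>2 / real n"
  using assms(2)
proof (induction k)
  case (Suc k)
  define q where "q k = real (j choose k) / real (n choose k)" for k
  \<comment> \<open>Truncated subtraction makes \<open>r\<close> vanish for
    \<open>k \<ge> j\<close>, exactly when \<open>j choose Suc k\<close> does.\<close>
  define r where "r = real (j - k) / real (n - k)"
  define p where "p = real j / real n"
  have k: "k < n" using Suc by simp
  have absorb: "real (Suc k) * real (m choose Suc k) = real (m - k) * real (m choose k)" for m
    by (metis binomial_absorb_comp binomial_absorption of_nat_mult)
  have "q (Suc k) = (real (Suc k) * real (j choose Suc k)) / (real (Suc k) * real (n choose Suc k))"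
    by (simp add: q_def)
  also have "\<dots> = q k * r" unfolding absorb by (simp add: q_def r_def mult.commute)
  finally have step: "q (Suc k) = q k * r" .
  have q: "0 \<le> q k" "q k \<le> 1"
    using assms(1) k by (auto simp: q_def divide_le_eq_1 binomial_right_mono)
  have p: "0 \<le> p" "p \<le> 1" using assms(1,3) by (auto simp: p_def)
  have r: "\<bar>r - p\<bar> \<le> real k / real n"
  proof (cases "k \<le> j")
    case True
    have "p - r = real k * (real n - real j) / (real n * (real n - real k))"
      using True k assms by (simp add: p_def r_def of_nat_diff divide_simps) (simp add: algebra_simps)
    also have "\<dots> = real k / real n * ((real n - real j) / (real n - real k))" by simp
    finally have eq: "p - r = real k / real n * ((real n - real j) / (real n - real k))" .
    have "(real n - real j) / (real n - real k) \<le> 1" "0 \<le> (real n - real j) / (real n - real k)"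
      using True k assms by auto
    then have "0 \<le> p - r" "p - r \<le> real k / real n * 1"
      unfolding eq by (intro mult_nonneg_nonneg mult_left_mono; simp)+
    then show ?thesis by simp
  next
    case False
    then show ?thesis using assms(3) by (simp add: r_def p_def divide_right_mono)
  qed
  have "q k * r - p ^ Suc k = q k * (r - p) + p * (q k - p ^ k)" by (simp add: algebra_simps)
  then have "\<bar>q k * r - p ^ Suc k\<bar> \<le> \<bar>q k * (r - p)\<bar> + \<bar>p * (q k - p ^ k)\<bar>" by linarith
  also have "\<dots> \<le> 1 * (real k / real n) + 1 * ((real k)\<^sup>2 / real n)"
    unfolding abs_mult using q p r Suc
    by (intro add_mono mult_mono) (auto simp: q_def p_def)
  also have "\<dots> \<le> (real (Suc k))\<^sup>2 / real n"
    using assms(3) by (simp add: add_divide_distrib[symmetric] divide_right_mono power2_eq_square algebra_simps)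
  finally show ?case by (simp add: step[unfolded q_def] p_def q_def)
qed simp

text \<open>The Bernstein weights of the moment sequence are probability
  measures on the unit interval, and any weak limit of them has the prescribed moments.\<close>

lemma hausdorff_moment_problem:
  fixes v :: "nat \<Rightarrow> nat \<Rightarrow> real"
  assumes v: "\<And>j l. v j l = v (Suc j) l + v j (Suc l)"
    and nonneg: "\<And>j l. 0 \<le> v j l" and one: "v 0 0 = 1"
  shows "\<exists>M. real_distribution M \<and> (AE t in M. t \<in> {0..1}) \<and> (\<forall>k. (LINT t|M. t ^ k) = v k 0)"
proof -
  \<comment> \<open>Degree \<open>Suc n\<close> instead of \<open>n\<close> keeps the denominator of
    the nodes \<open>real j / real (Suc n)\<close> positive.\<close>
  define w where "w n j = real (Suc n choose j) * v j (Suc n - j)" for n j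
  define \<nu> where "\<nu> n = distr (point_measure {..Suc n} (w n)) borel (\<lambda>j. real j / real (Suc n))" for n
  have w_nonneg: "0 \<le> w n j" for n j by (simp add: w_def nonneg)
  have w_sum: "(\<Sum>j\<le>Suc n. w n j) = 1" for n
    unfolding w_def using binomial_sum_difference_array[of v "Suc n", OF v] one by simp
  have prob: "prob_space (point_measure {..Suc n} (w n))" for n
    by (rule prob_space_point_measure) (use w_nonneg w_sum in \<open>auto simp del: sum.atMost_Suc\<close>)
  have dist: "real_distribution (\<nu> n)" for n
  proof -
    have "prob_space (\<nu> n)" unfolding \<nu>_def by (rule prob_space.prob_space_distr[OF prob]) simp
    then show ?thesis by (simp add: real_distribution_def real_distribution_axioms_def \<nu>_def)
  qed
  have int: "(LINT t|\<nu> n. f t) = (\<Sum>j\<le>Suc n. w n j * f (real j / real (Suc n)))"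
    if [measurable]: "f \<in> borel_measurable borel" for f :: "real \<Rightarrow> real" and n
    unfolding \<nu>_def
    by (subst integral_distr) (auto simp: lebesgue_integral_point_measure_finite w_nonneg simp del: sum.atMost_Suc)
  \<comment> \<open>Tightness is phrased with half-open intervals \<open>{a<..b}\<close>; the left
    end -1 keeps the node 0 inside.\<close>
  have mass: "measure (\<nu> n) {-1<..1} = 1" for n
  proof -
    interpret real_distribution "\<nu> n" by (rule dist)
    have "measure (\<nu> n) {-1<..1} = (LINT t|\<nu> n. indicator {-1<..1} t)" by simp
    also have "\<dots> = (\<Sum>j\<le>Suc n. w n j * indicator {-1<..1} (real j / real (Suc n)))"
      by (rule int) simp
    also have "\<dots> = (\<Sum>j\<le>Suc n. w n j * 1)"
    proof (rule sum.cong[OF refl])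
      fix j assume "j \<in> {..Suc n}"
      then have "real j / real (Suc n) \<in> {-1<..1}" by (auto simp: divide_le_eq_1 intro: less_le_trans[of _ 0])
      then show "w n j * indicator {-1<..1} (real j / real (Suc n)) = w n j * 1" by simp
    qed
    finally show ?thesis using w_sum by simp
  qed
  have "tight \<nu>"
    unfolding tight_def
  proof (intro conjI allI impI dist)
    show "\<exists>a b. a < b \<and> (\<forall>n. 1 - \<epsilon> < measure (\<nu> n) {a<..b})" if "0 < \<epsilon>" for \<epsilon> :: real
      by (rule exI[of _ "-1"], rule exI[of _ 1]) (use mass that in simp)
  qed
  then obtain r N where r: "strict_mono r" and N: "real_distribution N"
    and lim: "weak_conv_m (\<nu> \<circ> id \<circ> r) N"
    using tight_imp_convergent_subsubsequence[of \<nu> id] by (auto simp: strict_mono_def)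
  \<comment> \<open>Weak convergence is tested on bounded continuous functions, and monomials are
    unbounded on the line. The clamp \<open>c\<close> makes them bounded and fixes all
    nodes.\<close>
  define c where "c t = max 0 (min 1 t)" for t :: real
  have c01: "c t \<in> {0..1}" for t by (auto simp: c_def)
  have contc: "isCont c t" for t unfolding c_def by (intro continuous_intros)
  have [measurable]: "c \<in> borel_measurable borel" unfolding c_def by measurable
  have conv: "(\<lambda>n. LINT t|\<nu> n. c t ^ k) \<longlonglongrightarrow> v k 0" for k
  proof (rule LIM_zero_cancel, rule Lim_null_comparison)
    show "(\<lambda>n. (real k)\<^sup>2 * inverse (real (Suc n))) \<longlonglongrightarrow> 0"
      using tendsto_mult[OF tendsto_const LIMSEQ_inverse_real_of_nat, of "(real k)\<^sup>2"] by simp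
    have "\<bar>(LINT t|\<nu> n. c t ^ k) - v k 0\<bar> \<le> (real k)\<^sup>2 * inverse (real (Suc n))" if "k \<le> Suc n" for n
    proof -
      have "(LINT t|\<nu> n. c t ^ k) = (\<Sum>j\<le>Suc n. w n j * c (real j / real (Suc n)) ^ k)"
        by (rule int) measurable
      also have "\<dots> = (\<Sum>j\<le>Suc n. w n j * (real j / real (Suc n)) ^ k)"
      proof (rule sum.cong[OF refl])
        fix j assume "j \<in> {..Suc n}"
        then have "real j / real (Suc n) \<le> 1" "0 \<le> real j / real (Suc n)" by (simp_all add: divide_le_eq_1)
        then show "w n j * c (real j / real (Suc n)) ^ k = w n j * (real j / real (Suc n)) ^ k"
          unfolding c_def by (simp only: min_absorb2 max_absorb2)
      qed
      finally have "\<bar>(LINT t|\<nu> n. c t ^ k) - v k 0\<bar> =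
        \<bar>\<Sum>j\<le>Suc n. w n j * (real (j choose k) / real (Suc n choose k) - (real j / real (Suc n)) ^ k)\<bar>"
        unfolding right_diff_distrib sum_subtractf
        using binomial_moment_difference_array[of v k "Suc n", OF v that]
        by (simp add: w_def abs_minus_commute del: sum.atMost_Suc)
      also have "\<dots> \<le> (\<Sum>j\<le>Suc n. w n j * ((real k)\<^sup>2 / real (Suc n)))"
      proof (rule order_trans[OF sum_abs sum_mono])
        fix j assume "j \<in> {..Suc n}"
        then show "\<bar>w n j * (real (j choose k) / real (Suc n choose k) - (real j / real (Suc n)) ^ k)\<bar>
            \<le> w n j * ((real k)\<^sup>2 / real (Suc n))"
          unfolding abs_mult abs_of_nonneg[OF w_nonneg] using that
          by (intro mult_left_mono binomial_ratio_power_bound w_nonneg) auto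
      qed
      also have "\<dots> = (real k)\<^sup>2 * inverse (real (Suc n))"
        unfolding sum_distrib_right[symmetric] w_sum by (simp add: divide_inverse)
      finally show ?thesis .
    qed
    then show "\<forall>\<^sub>F n in sequentially. norm ((LINT t|\<nu> n. c t ^ k) - v k 0) \<le> (real k)\<^sup>2 * inverse (real (Suc n))"
      unfolding eventually_sequentially by (intro exI[of _ k]) auto
  qed
  interpret N: real_distribution N by (rule N)
  have mom: "(LINT t|N. c t ^ k) = v k 0" for k
  proof -
    have "(\<lambda>n. LINT t|(\<nu> \<circ> id \<circ> r) n. c t ^ k) \<longlonglongrightarrow> (LINT t|N. c t ^ k)"
    proof (rule weak_conv_imp_integral_bdd_continuous_conv[OF _ N lim, where B = 1])
      show "real_distribution ((\<nu> \<circ> id \<circ> r) n)" for n using dist by simp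
      show "isCont (\<lambda>t. c t ^ k) t" for t by (intro continuous_intros contc)
      show "norm (c t ^ k) \<le> 1" for t using c01[of t] by (auto simp: power_abs intro!: power_le_one)
    qed
    moreover have "(\<lambda>n. LINT t|(\<nu> \<circ> id \<circ> r) n. c t ^ k) \<longlonglongrightarrow> v k 0"
      using LIMSEQ_subseq_LIMSEQ[OF conv r] by (simp add: o_def)
    ultimately show ?thesis by (rule LIMSEQ_unique)
  qed
  \<comment> \<open>The image under \<open>c\<close> lies in the unit interval by construction, and
    its moments are the clamped moments of \<open>N\<close> just computed.\<close>
  let ?M = "distr N borel c"
  have [measurable]: "c \<in> measurable N borel" by measurable
  have "prob_space ?M" by (rule N.prob_space_distr) measurable
  then have "real_distribution ?M" by (simp add: real_distribution_def real_distribution_axioms_def)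
  moreover have "AE t in ?M. t \<in> {0..1}" using c01 by (subst AE_distr_iff) auto
  moreover have "(LINT t|?M. t ^ k) = v k 0" for k
    by (subst integral_distr) (auto simp: mom)
  ultimately show ?thesis by blast
qed

section \<open>The spectral theorem\<close>

lemma linear_funpow:
  fixes S :: "'a::real_vector \<Rightarrow> 'a"
  assumes "linear S"
  shows "linear (S ^^ k)"
  by (induction k) (auto simp: linear_compose[OF _ assms, unfolded o_def] linear_id[unfolded id_def])

lemma bounded_linear_funpow:
  fixes S :: "'a::real_normed_vector \<Rightarrow> 'a"
  assumes "bounded_linear S"
  shows "bounded_linear (S ^^ k)"
proof (induction k)
  case (Suc k)
  then show ?case using bounded_linear_compose[OF assms] by (simp add: o_def)
qed (simp add: bounded_linear_ident)

lemma selfadjoint_funpow: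
  assumes "selfadjoint S"
  shows "selfadjoint (S ^^ k)"
proof (induction k)
  case (Suc k)
  then show ?case using assms by (simp add: selfadjoint_def funpow_swap1)
qed (simp add: selfadjoint_def)

lemma funpow_commute:
  assumes "\<And>x. S (R x) = R (S x)"
  shows "S ((R ^^ l) x) = (R ^^ l) (S x)"
  by (induction l) (auto simp: assms)

text \<open>Even powers are moved to both sides of the inner product, which leaves the four cases
  with exponents at most 1; the mixed one is \<open>S R = S R S + R S R\<close>, because \<open>S + R = 1\<close>.\<close>

lemma inner_contraction_powers_nonneg:
  fixes S :: "'a::real_inner \<Rightarrow> 'a"
  assumes lin: "linear S" and sa: "selfadjoint S"
    and pos: "\<And>x. 0 \<le> S x \<bullet> x" and le: "\<And>x. S x \<bullet> x \<le> x \<bullet> x"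
  defines "R \<equiv> \<lambda>x. x - S x"
  shows "0 \<le> (S ^^ k) ((R ^^ l) x) \<bullet> x"
proof -
  have saS: "S x \<bullet> y = x \<bullet> S y" for x y using sa by (simp add: selfadjoint_def)
  have saR: "R x \<bullet> y = x \<bullet> R y" for x y by (simp add: R_def inner_simps saS)
  have posR: "0 \<le> R x \<bullet> x" for x using le by (simp add: R_def inner_simps)
  have SR: "S (R x) = R (S x)" for x by (simp add: R_def linear_diff[OF lin])
  have RSk: "R ((S ^^ k) x) = (S ^^ k) (R x)" for k x by (rule funpow_commute) (simp add: SR)
  have SRl: "S ((R ^^ l) x) = (R ^^ l) (S x)" for l x by (rule funpow_commute) (simp add: SR)
  have base: "0 \<le> (S ^^ k) ((R ^^ l) x) \<bullet> x" if "k \<le> 1" "l \<le> 1" for k l x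
  proof -
    have "S (R x) \<bullet> x = S (R x) \<bullet> R x + R (S x) \<bullet> S x"
      unfolding saR[of "S x" "S x"] SR[symmetric] saS[symmetric] by (simp add: SR R_def inner_simps saS linear_diff[OF lin])
    then have "0 \<le> S (R x) \<bullet> x" using pos[of "R x"] posR[of "S x"] by linarith
    moreover have "k = 0 \<or> k = 1" "l = 0 \<or> l = 1" using that by auto
    ultimately show ?thesis using pos posR by auto
  qed
  have stepS: "(S ^^ Suc (Suc k)) ((R ^^ l) x) \<bullet> x = (S ^^ k) ((R ^^ l) (S x)) \<bullet> S x" for k l x
  proof -
    have "(S ^^ Suc (Suc k)) y = S ((S ^^ k) (S y))" for y by (simp add: funpow_swap1)
    then show ?thesis by (simp only: saS SRl)
  qed
  have stepR: "(S ^^ k) ((R ^^ Suc (Suc l)) x) \<bullet> x = (S ^^ k) ((R ^^ l) (R x)) \<bullet> R x" for k l x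
  proof -
    have "(R ^^ Suc (Suc l)) y = R ((R ^^ l) (R y))" for y by (simp add: funpow_swap1)
    then show ?thesis by (simp only: saR RSk[symmetric])
  qed
  have onlyR: "\<forall>x. 0 \<le> (S ^^ k) ((R ^^ l) x) \<bullet> x" if "k \<le> 1" for k l
  proof (induction l rule: less_induct)
    case (less l)
    show ?case
    proof (cases "l \<le> 1")
      case False
      then obtain l' where "l = Suc (Suc l')" by (metis not_less_eq_eq not0_implies_Suc One_nat_def le0)
      then show ?thesis using less[of l'] stepR by simp
    qed (use base that in blast)
  qed
  have "\<forall>x. 0 \<le> (S ^^ k) ((R ^^ l) x) \<bullet> x" for k
  proof (induction k rule: less_induct)
    case (less k)
    show ?case
    proof (cases "k \<le> 1")
      case False
      then obtain k' where "k = Suc (Suc k')" by (metis not_less_eq_eq not0_implies_Suc One_nat_def le0)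
      then show ?thesis using less[of k'] stepS by simp
    qed (use onlyR in blast)
  qed
  then show ?thesis by blast
qed

text \<open>A unit vector makes the moment of order 0 equal to 1, so the moment problem yields a
  probability measure. Dividing by the norm brings the spectrum into the unit interval; the image
  under \<open>t \<mapsto> b * t\<close> undoes this.\<close>

lemma spectral_distribution:
  fixes T :: "'a::real_inner \<Rightarrow> 'a"
  assumes T: "bounded_linear T" and sa: "selfadjoint T" and pos: "\<And>x. 0 \<le> T x \<bullet> x"
    and u: "norm u = 1"
  shows "\<exists>M. real_distribution M \<and> (AE t in M. t \<in> {0..onorm T}) \<and> (\<forall>k. (LINT t|M. t ^ k) = (T ^^ k) u \<bullet> u)"
proof -
  interpret T: bounded_linear T by fact
  define b where "b = onorm T"
  have b: "0 \<le> b" by (simp add: b_def onorm_pos_le[OF T])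
  \<comment> \<open>If \<open>b = 0\<close>, then \<open>inverse b = 0\<close> and
    \<open>S = 0\<close>. Since \<open>T = 0\<close> too, \<open>TS\<close> still holds, and the
    final measure is the point mass at 0.\<close>
  define S where "S x = inverse b *\<^sub>R T x" for x
  define R where "R x = x - S x" for x
  have linS: "linear S" unfolding S_def by (intro linearI) (simp_all add: T.add T.scaleR scaleR_add_right)
  have saS: "selfadjoint S" using sa by (simp add: selfadjoint_def S_def)
  have le: "S x \<bullet> x \<le> x \<bullet> x" for x
  proof (cases "b = 0")
    case False
    have "T x \<bullet> x \<le> norm (T x) * norm x" by (rule norm_cauchy_schwarz)
    also have "\<dots> \<le> b * norm x * norm x"
      using onorm[OF T, of x] by (intro mult_right_mono) (auto simp: b_def)
    finally have "T x \<bullet> x \<le> b * (x \<bullet> x)" by (simp add: power2_norm_eq_inner[symmetric] power2_eq_square mult_ac)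
    then show ?thesis using b False by (simp add: S_def field_simps)
  qed (simp add: S_def)
  have posS: "0 \<le> S x \<bullet> x" for x using pos b by (simp add: S_def)
  have TS: "T x = b *\<^sub>R S x" for x
  proof (cases "b = 0")
    case True
    then have "norm (T x) \<le> 0" using onorm[OF T, of x] by (simp add: b_def)
    then show ?thesis using True by simp
  qed (simp add: S_def)
  have Tk: "(T ^^ k) x = (b ^ k) *\<^sub>R (S ^^ k) x" for k x
    by (induction k) (auto simp: TS linear_scale[OF linS])
  define v where "v j l = (S ^^ j) ((R ^^ l) u) \<bullet> u" for j l
  have "\<exists>M. real_distribution M \<and> (AE t in M. t \<in> {0..1}) \<and> (\<forall>k. (LINT t|M. t ^ k) = v k 0)"
  proof (rule hausdorff_moment_problem)
    show "v j l = v (Suc j) l + v j (Suc l)" for j l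
      by (simp add: v_def funpow_swap1[of S] R_def[of "(R ^^ l) u"] linear_diff[OF linear_funpow[OF linS]] inner_diff_left)
    show "0 \<le> v j l" for j l
      unfolding v_def R_def by (rule inner_contraction_powers_nonneg[OF linS saS posS le])
    show "v 0 0 = 1" by (simp add: v_def power2_norm_eq_inner[symmetric] u)
  qed
  then obtain M where M: "real_distribution M" "AE t in M. t \<in> {0..1}" "\<And>k. (LINT t|M. t ^ k) = v k 0" by blast
  interpret M: real_distribution M by fact
  let ?N = "distr M borel (\<lambda>t. b * t)"
  have [measurable]: "(\<lambda>t. b * t) \<in> measurable M borel" by measurable
  have "prob_space ?N" by (rule M.prob_space_distr) measurable
  then have "real_distribution ?N" by (simp add: real_distribution_def real_distribution_axioms_def)
  moreover have "AE t in ?N. t \<in> {0..b}"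
  proof (subst AE_distr_iff)
    show "AE t in M. b * t \<in> {0..b}"
      using M(2) by eventually_elim (use b in \<open>auto simp: mult_left_le\<close>)
  qed auto
  moreover have "(LINT t|?N. t ^ k) = (T ^^ k) u \<bullet> u" for k
    by (subst integral_distr) (auto simp: power_mult_distrib M(3) v_def Tk)
  ultimately show ?thesis unfolding b_def by blast
qed

lemma spectral_measure_exists:
  fixes T :: "'a::real_inner \<Rightarrow> 'a"
  assumes T: "bounded_linear T" and sa: "selfadjoint T" and pos: "\<And>x. 0 \<le> T x \<bullet> x"
  shows "\<exists>M. finite_measure M \<and> sets M = sets borel \<and> (AE t in M. t \<in> {0..onorm T}) \<and>
    (\<forall>k. (LINT t|M. t ^ k) = (T ^^ k) x \<bullet> x)"
proof (cases "x = 0")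
  case True
  interpret T: bounded_linear T by fact
  have "(T ^^ k) 0 = 0" for k by (induction k) (auto simp: T.zero)
  then show ?thesis using True
    by (intro exI[of _ "null_measure borel"]) (auto intro!: finite_measureI AE_I[of _ _ UNIV])
next
  case False
  define u where "u = x /\<^sub>R norm x"
  have "norm u = 1" using False by (simp add: u_def)
  then obtain M where M: "real_distribution M" "AE t in M. t \<in> {0..onorm T}"
    "\<And>k. (LINT t|M. t ^ k) = (T ^^ k) u \<bullet> u"
    using spectral_distribution[OF T sa pos, of u] by blast
  interpret M: real_distribution M by fact
  let ?N = "density M (\<lambda>t. ennreal ((norm x)\<^sup>2))"
  have "finite_measure ?N"
    by (rule finite_measureI) (simp add: emeasure_density M.emeasure_space_1 ennreal_mult_eq_top_iff)
  moreover have "AE t in ?N. t \<in> {0..onorm T}"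
    using M(2) by (subst AE_density) auto
  moreover have "(LINT t|?N. t ^ k) = (T ^^ k) x \<bullet> x" for k
  proof -
    interpret Tk: bounded_linear "T ^^ k" by (rule bounded_linear_funpow[OF T])
    have "(LINT t|?N. t ^ k) = (norm x)\<^sup>2 * (LINT t|M. t ^ k)"
      by (subst integral_density) auto
    then show ?thesis using False by (simp add: M(3) u_def Tk.scaleR power2_eq_square field_simps)
  qed
  moreover have "sets ?N = sets borel" by simp
  ultimately show ?thesis by blast
qed

text \<open>Used to recognize \<open>scalar_spectral_measure E x\<close>, assembled by
  \<open>measure_of\<close> from a set function, as the moment measure \<open>m x\<close>
  itself.\<close>

lemma measure_of_emeasure_borel:
  fixes M :: "real measure"
  assumes "finite_measure M" "sets M = sets borel" "\<And>S. S \<in> sets borel \<Longrightarrow> h S = measure M S"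
  shows "measure_of UNIV (sets borel) (\<lambda>S. ennreal (h S)) = M"
proof -
  have sp: "space M = UNIV" using assms(2) by (metis sets_eq_imp_space_eq space_borel)
  interpret finite_measure M by fact
  have "measure_of UNIV (sets borel) (\<lambda>S. ennreal (h S)) = measure_of (space M) (sets M) (emeasure M)"
    unfolding sp assms(2)
    by (rule measure_of_eq) (use assms(3) sets.sigma_sets_eq[of "borel :: real measure"] in \<open>auto simp: emeasure_eq_measure\<close>)
  then show ?thesis by (simp add: measure_of_of_measure)
qed

lemma set_integral_full:
  assumes "sets M = sets borel" "AE t in M. t \<in> K" "K \<in> sets borel" "f \<in> borel_measurable borel"
  shows "(LINT t:K|M. f t) = (LINT t|M. f t)"
  unfolding set_lebesgue_integral_def
proof (rule integral_cong_AE)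
  show "AE t in M. indicator K t *\<^sub>R f t = f t" using assms(2) by eventually_elim simp
qed (use assms in \<open>simp_all add: measurable_cong_sets[OF assms(1) refl]\<close>)

text \<open>The measures \<open>m x\<close> are picked independently for each \<open>x\<close>;
  uniqueness of moments, inside the locale, links them. The projections are
  \<open>Op (indicator S)\<close>: idempotent by multiplicativity, and strongly countably additive
  by \<open>norm_Op\<close>.\<close>

theorem spectral_theorem:
  fixes T :: "'a::{real_inner, complete_space} \<Rightarrow> 'a"
  assumes T: "bounded_linear T" and sa: "selfadjoint T" and pos: "\<And>x. 0 \<le> T x \<bullet> x"
  shows "\<exists>E. projection_valued_measure E \<and> E {0..onorm T} = id \<and>
              has_spectral_integral E {0..onorm T} (\<lambda>t. t) T"
proof -
  let ?K = "{0..onorm T}"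
  obtain m where m: "\<And>x. finite_measure (m x)" "\<And>x. sets (m x) = sets borel"
    "\<And>x. AE t in m x. t \<in> ?K" "\<And>x k. (LINT t|m x. t ^ k) = (T ^^ k) x \<bullet> x"
    using spectral_measure_exists[OF assms] by metis
  interpret spectral_calculus m ?K "UNIV :: nat set" "\<lambda>k t. t ^ k" "\<lambda>k. T ^^ k"
  proof (intro spectral_calculus.intro, goal_cases)
    case (3 x)
    show ?case by (rule m(3))
  next
    case (4 i)
    show ?case by (rule bounded_borel_on_continuous) (auto intro!: continuous_intros)
  next
    case (5 \<Lambda> f)
    then show ?case using sigma_functional_eq_zero_power[OF compact_Icc] by blast
  next
    case (9 i j)
    show ?case by (rule bexI[of _ "i + j"]) (auto simp: power_add funpow_add)
  next
    case 10
    show ?case by (rule bexI[of _ 0]) auto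
  qed (use m in \<open>auto intro: bounded_linear_funpow[OF T] selfadjoint_funpow[OF sa]\<close>)
  define E where "E S = Op (indicator S)" for S
  have ind_mult: "(\<lambda>t. indicator S t * indicator S' t) = (indicator (S \<inter> S') :: real \<Rightarrow> real)" for S S'
    by (auto simp: indicator_def)
  have proj: "orthogonal_projection (E S)" if "S \<in> sets borel" for S
    using that Op_mult[of "indicator S" "indicator S"]
    by (auto simp: orthogonal_projection_def E_def bounded_linear_Op selfadjoint_Op ind_mult)
  have E_one: "E S = id" if "S \<in> sets borel" "?K \<subseteq> S" for S
  proof -
    have "E S = Op (\<lambda>t. t ^ 0)" unfolding E_def by (rule Op_cong) (use that in auto)
    also have "\<dots> = id" using Op_d[of 0] by simp
    finally show ?thesis .
  qed
  have sums: "(\<lambda>n. E (F n) x) sums E (\<Union>n. F n) x"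
    if F: "range F \<subseteq> sets borel" and disj: "disjoint_family F" for F :: "nat \<Rightarrow> real set" and x
  proof -
    have Fn: "F n \<in> sets borel" for n using F by auto
    have UFn [measurable]: "(\<Union>i<n. F i) \<in> sets borel" "(\<Union>i. F i) \<in> sets borel" for n
      using Fn by auto
    have partial: "(\<Sum>i<n. E (F i) x) = E (\<Union>i<n. F i) x" for n
    proof (induction n)
      case 0
      have "indicator {} = (\<lambda>t. 1 - 1 :: real)" by auto
      then have "E {} x = Op (\<lambda>t. 1 - 1) x"
        unfolding E_def by (rule arg_cong[where f = "\<lambda>f. Op f x"])
      also have "\<dots> = 0" by (subst Op_diff) auto
      finally show ?case by simp
    next
      case (Suc n)
      have "F n \<inter> F i = {}" if "i < n" for i
        using disj that by (auto simp: disjoint_family_on_def)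
      then have "indicator (\<Union>i<Suc n. F i) = (\<lambda>t. indicator (\<Union>i<n. F i) t + indicator (F n) t :: real)"
        by (auto simp: fun_eq_iff indicator_def less_Suc_eq)
      then show ?case using Suc Op_add[of "indicator (\<Union>i<n. F i)" "indicator (F n)" x] Fn UFn
        by (simp add: E_def)
    qed
    \<comment> \<open>The indicator of the remaining tail. Its square tends to 0 pointwise and is at
      most 1, so \<open>norm (Op (D n) x)\<close> tends to 0.\<close>
    define D where "D n t = (indicator (\<Union>i. F i) t - indicator (\<Union>i<n. F i) t :: real)" for n t
    have D: "D n \<in> bounded_borel_on ?K" for n
      unfolding D_def using UFn by blast
    have "(\<lambda>n. LINT t|m x. (D n t)\<^sup>2) \<longlonglongrightarrow> (LINT t|m x. 0)"
    proof (rule sigma_functional_tendsto[OF sigma_functional_m, where B = 1])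
      show "(\<lambda>t. (D n t)\<^sup>2) \<in> borel_measurable borel" for n unfolding D_def by measurable
      show "\<bar>(D n t)\<^sup>2\<bar> \<le> 1" for n t by (auto simp: D_def indicator_def)
      show "(\<lambda>n. (D n t)\<^sup>2) \<longlonglongrightarrow> 0" for t
        unfolding D_def
        using tendsto_power[OF tendsto_diff[OF tendsto_const LIMSEQ_indicator_UN[of F t]],
            of "indicator (\<Union>i. F i) t :: real" 2] by simp
    qed simp
    then have "(\<lambda>n. (norm (Op (D n) x))\<^sup>2) \<longlonglongrightarrow> 0" by (simp only: norm_Op[OF D]) simp
    then have "(\<lambda>n. norm (Op (D n) x)) \<longlonglongrightarrow> 0"
      using tendsto_real_sqrt by fastforce
    then have "(\<lambda>n. Op (D n) x) \<longlonglongrightarrow> 0" by (rule tendsto_norm_zero_cancel)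
    then have "(\<lambda>n. E (\<Union>i. F i) x - Op (D n) x) \<longlonglongrightarrow> E (\<Union>i. F i) x - 0"
      by (intro tendsto_diff tendsto_const)
    moreover have "E (\<Union>i. F i) x - Op (D n) x = (\<Sum>i<n. E (F i) x)" for n
      using Op_diff[of "indicator (\<Union>i. F i)" "indicator (\<Union>i<n. F i)" x] UFn
      unfolding partial D_def by (simp add: E_def)
    ultimately show ?thesis by (simp add: sums_def)
  qed
  have "projection_valued_measure E"
    unfolding projection_valued_measure_def using proj E_one[of UNIV] sums by auto
  moreover have "has_spectral_integral E ?K (\<lambda>t. t) T"
  proof -
    have "scalar_spectral_measure E x = m x" for x
      unfolding scalar_spectral_measure_def
    proof (rule measure_of_emeasure_borel[OF m(1,2)])
      fix S :: "real set" assume S: "S \<in> sets borel"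
      have "space (m x) = UNIV" using m(2)[of x] by (metis sets_eq_imp_space_eq space_borel)
      then show "E S x \<bullet> x = measure (m x) S" using S by (simp add: E_def Op_form)
    qed
    moreover have "T x \<bullet> x = (LINT t:?K|m x. t)" for x
      using m(4)[of x 1] set_integral_full[OF m(2,3), where f = "\<lambda>t. t"] by simp
    ultimately show ?thesis using T sa by (simp add: has_spectral_integral_def)
  qed
  moreover have "E ?K = id" by (rule E_one) simp_all
  ultimately show ?thesis by (intro exI[of _ E] conjI)
qed

section \<open>Functional calculus of the spectral resolution\<close>

text \<open>From here on \<open>E\<close> is arbitrary, because the value of
  \<open>spectral_resolution\<close> is a choice and need not be the resolution constructed
  above.\<close>

context
  fixes E :: "real set \<Rightarrow> 'a::{real_inner, complete_space} \<Rightarrow> 'a"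
  assumes E: "projection_valued_measure E"
begin

lemma pvm_projection: "S \<in> sets borel \<Longrightarrow> orthogonal_projection (E S)"
  using E by (simp add: projection_valued_measure_def)

lemma pvm_sums:
  "range F \<subseteq> sets borel \<Longrightarrow> disjoint_family F \<Longrightarrow> (\<lambda>n. E (F n) x) sums E (\<Union>n. F n) x"
  using E by (simp add: projection_valued_measure_def)

text \<open>Countable additivity over empty sets: a convergent series has terms tending to 0, and
  here the term is constant.\<close>

lemma pvm_empty: "E {} x = 0"
proof -
  have "(\<lambda>n::nat. E {} x) sums E {} x"
    using pvm_sums[of "\<lambda>_. {}" x] by (simp add: disjoint_family_on_def)
  then have "(\<lambda>n::nat. E {} x) \<longlonglongrightarrow> 0" by (intro summable_LIMSEQ_zero sums_summable)
  then show ?thesis by (simp add: LIMSEQ_const_iff)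
qed

lemma pvm_Un:
  assumes "S \<in> sets borel" "S' \<in> sets borel" "S \<inter> S' = {}"
  shows "E (S \<union> S') x = E S x + E S' x"
proof -
  have "(\<lambda>n. E (binaryset S S' n) x) sums E (\<Union>n. binaryset S S' n) x"
    by (rule pvm_sums) (use assms in \<open>auto simp: range_binaryset_eq disjoint_family_on_def binaryset_def\<close>)
  moreover have "(\<lambda>n. E (binaryset S S' n) x) sums (E S x + E S' x)"
    by (rule binaryset_sums) (simp add: pvm_empty)
  ultimately show ?thesis by (simp add: UN_binaryset_eq sums_unique2)
qed

lemma pvm_linear: "S \<in> sets borel \<Longrightarrow> bounded_linear (E S)"
  and pvm_idem: "S \<in> sets borel \<Longrightarrow> E S (E S x) = E S x"
  and pvm_selfadjoint: "S \<in> sets borel \<Longrightarrow> selfadjoint (E S)"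
  using pvm_projection[of S] by (auto simp: orthogonal_projection_def fun_eq_iff)

text \<open>Pure algebra: if \<open>P\<close>, \<open>Q\<close> and \<open>P + Q\<close> are
  idempotent, then \<open>P Q + Q P = 0\<close>. Multiplying by \<open>P\<close> on the left and on
  the right gives \<open>P Q = - P Q P = Q P\<close>, hence \<open>2 P Q = 0\<close>.\<close>

lemma pvm_disjoint:
  assumes S: "S \<in> sets borel" and S': "S' \<in> sets borel" and disj: "S \<inter> S' = {}"
  shows "E S (E S' x) = 0"
proof -
  interpret P: bounded_linear "E S" by (rule pvm_linear[OF S])
  interpret Q: bounded_linear "E S'" by (rule pvm_linear[OF S'])
  note idem = pvm_idem[OF S] pvm_idem[OF S']
  have anti: "E S (E S' x) + E S' (E S x) = 0" for x
    using pvm_idem[of "S \<union> S'" x] S S' by (simp add: pvm_Un[OF S S' disj] P.add Q.add idem)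
  have "E S (E S' x) + E S (E S' (E S x)) = 0"
    using arg_cong[OF anti[of x], of "E S"] by (simp add: P.add P.zero idem)
  moreover have "E S (E S' (E S x)) + E S' (E S x) = 0"
    using anti[of "E S x"] by (simp add: idem)
  ultimately have "E S (E S' x) = E S' (E S x)" by (simp add: add_eq_0_iff)
  then have "2 *\<^sub>R E S (E S' x) = 0" using anti[of x] by (simp add: scaleR_2)
  then show ?thesis by simp
qed

text \<open>Split \<open>S\<close> and \<open>S'\<close> along \<open>S \<inter> S'\<close>; of the
  four products only the square of the common part survives.\<close>

lemma pvm_Int:
  assumes S: "S \<in> sets borel" and S': "S' \<in> sets borel"
  shows "E S (E S' x) = E (S \<inter> S') x"
proof -
  have [simp]: "S \<inter> S' \<in> sets borel" "S' \<inter> S \<in> sets borel" "S - S' \<in> sets borel" "S' - S \<in> sets borel" using S S' by auto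
  interpret R: bounded_linear "E (S \<inter> S')" by (rule pvm_linear) simp
  interpret D: bounded_linear "E (S - S')" by (rule pvm_linear) simp
  have "E S y = E (S \<inter> S') y + E (S - S') y" for y
    using pvm_Un[of "S \<inter> S'" "S - S'" y] by (simp add: Int_Diff_Un Int_Diff_disjoint)
  moreover have "E S' y = E (S \<inter> S') y + E (S' - S) y" for y
    using pvm_Un[of "S \<inter> S'" "S' - S" y] by (simp add: Int_commute[of S] Int_Diff_Un Int_Diff_disjoint)
  moreover have "E (S \<inter> S') (E (S' - S) x) = 0" "E (S - S') (E (S \<inter> S') x) = 0" "E (S - S') (E (S' - S) x) = 0"
    by (rule pvm_disjoint; auto)+
  ultimately show ?thesis by (simp add: R.add D.add pvm_idem)
qed

lemma pvm_inner_nonneg: "S \<in> sets borel \<Longrightarrow> 0 \<le> E S x \<bullet> x"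
  using pvm_selfadjoint[of S] pvm_idem[of S x] inner_ge_zero[of "E S x"]
  by (metis selfadjoint_def inner_commute)

lemma sets_scalar_spectral_measure: "sets (scalar_spectral_measure E x) = sets borel"
  unfolding scalar_spectral_measure_def
  using sets.sigma_sets_eq[of "borel :: real measure"] by (simp add: sets_measure_of_conv)

lemma space_scalar_spectral_measure: "space (scalar_spectral_measure E x) = UNIV"
  using sets_eq_imp_space_eq[OF sets_scalar_spectral_measure] by simp

text \<open>\<open>measure_of\<close> takes over a set function only if it is positive and countably
  additive; both come from the strong sums of \<open>E\<close>, paired with
  \<open>x\<close>.\<close>

lemma emeasure_scalar_spectral_measure:
  assumes S: "S \<in> sets borel"
  shows "emeasure (scalar_spectral_measure E x) S = ennreal (E S x \<bullet> x)"
proof (rule emeasure_measure_of[OF scalar_spectral_measure_def])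
  show "positive (sets (scalar_spectral_measure E x)) (\<lambda>S. ennreal (E S x \<bullet> x))"
    by (simp add: positive_def pvm_empty)
  show "countably_additive (sets (scalar_spectral_measure E x)) (\<lambda>S. ennreal (E S x \<bullet> x))"
    unfolding countably_additive_def sets_scalar_spectral_measure
  proof (intro allI impI)
    fix F :: "nat \<Rightarrow> real set" assume F: "range F \<subseteq> sets borel" "disjoint_family F"
    show "(\<Sum>i. ennreal (E (F i) x \<bullet> x)) = ennreal (E (\<Union> (range F)) x \<bullet> x)"
      using F by (intro suminf_ennreal_eq pvm_inner_nonneg bounded_linear.sums[OF bounded_linear_inner_left] pvm_sums) auto
  qed
qed (simp_all add: sets_scalar_spectral_measure S)

lemma finite_scalar_spectral_measure: "finite_measure (scalar_spectral_measure E x)"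
  by (rule finite_measureI) (simp add: space_scalar_spectral_measure emeasure_scalar_spectral_measure)

lemma measure_scalar_spectral_measure:
  "S \<in> sets borel \<Longrightarrow> measure (scalar_spectral_measure E x) S = E S x \<bullet> x"
  by (simp add: measure_def emeasure_scalar_spectral_measure pvm_inner_nonneg)

lemma spectral_calculus_pvm:
  assumes K: "K \<in> sets borel" "E K = id"
  shows "spectral_calculus (scalar_spectral_measure E) K (sets borel) indicator E"
proof (intro spectral_calculus.intro, goal_cases)
  case (1 x)
  show ?case by (rule finite_scalar_spectral_measure)
next
  case (2 x)
  show ?case by (rule sets_scalar_spectral_measure)
next
  case (3 x)
  \<comment> \<open>Because \<open>E K\<close> is the identity, \<open>E (- K) x\<close> equals
    \<open>E K (E (- K) x)\<close>, a product over disjoint sets.\<close>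
  have "E (- K) x = 0" using pvm_disjoint[of K "- K" x] K by simp
  then have "emeasure (scalar_spectral_measure E x) (- K) = 0"
    using K by (simp add: emeasure_scalar_spectral_measure)
  then show ?case
    using K by (intro AE_I[of _ _ "- K"]) (auto simp: sets_scalar_spectral_measure)
next
  case (4 S)
  then show ?case by simp
next
  case (5 \<Lambda> f)
  then show ?case using sigma_functional_eq_zero_indicator[of K \<Lambda> f] by blast
next
  case (6 S)
  then show ?case by (rule pvm_linear)
next
  case (7 S)
  then show ?case by (rule pvm_selfadjoint)
next
  case (8 S x)
  then show ?case by (simp add: measure_scalar_spectral_measure space_scalar_spectral_measure)
next
  case (9 S S')
  then show ?case
    by (intro bexI[of _ "S \<inter> S'"]) (auto simp: pvm_Int indicator_def fun_eq_iff)
next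
  case 10
  have "E UNIV = id" using E by (simp add: projection_valued_measure_def)
  then show ?case by (intro bexI[of _ UNIV]) auto
qed

end

lemma spectral_resolution:
  fixes T :: "'a::{real_inner, complete_space} \<Rightarrow> 'a"
  assumes "bounded_linear T" "selfadjoint T" "\<And>x. 0 \<le> T x \<bullet> x"
  shows "projection_valued_measure (spectral_resolution T)"
    and "spectral_resolution T {0..onorm T} = id"
    and "has_spectral_integral (spectral_resolution T) {0..onorm T} (\<lambda>t. t) T"
  using someI_ex[OF spectral_theorem[OF assms]] by (auto simp: spectral_resolution_def)

text \<open>A set integral over the interval is by definition the integral of \<open>g\<close> cut
  off outside it, so the cut-off function is the one to feed into \<open>Op\<close>. Uniqueness for
  the \<open>THE\<close> is \<open>Op_eqI\<close>.\<close>

lemma functional_calculus_eq_Op: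
  fixes T :: "'a::{real_inner, complete_space} \<Rightarrow> 'a"
  assumes "spectral_calculus (scalar_spectral_measure (spectral_resolution T)) {0..onorm T} I d P"
    and g: "(\<lambda>t. indicator {0..onorm T} t * g t) \<in> bounded_borel_on {0..onorm T}"
  shows "functional_calculus T g =
    spectral_calculus.Op (scalar_spectral_measure (spectral_resolution T)) (\<lambda>t. indicator {0..onorm T} t * g t)"
    (is "_ = ?Op ?g")
proof -
  interpret spectral_calculus "scalar_spectral_measure (spectral_resolution T)" "{0..onorm T}" I d P by fact
  show ?thesis
    unfolding functional_calculus_def
  proof (rule the_equality)
    show "has_spectral_integral (spectral_resolution T) {0..onorm T} g (?Op ?g)"
      using g by (simp add: has_spectral_integral_def bounded_linear_Op selfadjoint_Op Op_form
          set_lebesgue_integral_def)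
  next
    fix G assume "has_spectral_integral (spectral_resolution T) {0..onorm T} g G"
    then show "G = ?Op ?g"
      by (intro Op_eqI[OF g, symmetric]) (auto simp: has_spectral_integral_def set_lebesgue_integral_def)
  qed
qed

text \<open>Off the finite exceptional set \<open>g\<close> is continuous on a Borel set; the
  exceptional values are put back as multiples of indicators of points.\<close>

lemma borel_measurable_piecewise_continuous:
  assumes "piecewise_continuous_on a b g"
  shows "(\<lambda>t. indicator {a..b} t * g t) \<in> borel_measurable borel"
proof -
  obtain S where S: "finite S" "continuous_on ({a..b} - S) g"
    using assms by (auto simp: piecewise_continuous_on_def)
  have "(\<lambda>t. indicator ({a..b} - S) t *\<^sub>R g t) \<in> borel_measurable borel"
    by (rule borel_measurable_continuous_on_indicator)
      (use S in \<open>auto intro: borel_closed finite_imp_closed\<close>)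
  moreover have "(\<lambda>t. \<Sum>s\<in>S \<inter> {a..b}. g s * indicator {s} t) \<in> borel_measurable borel" by measurable
  ultimately have "(\<lambda>t. indicator ({a..b} - S) t *\<^sub>R g t + (\<Sum>s\<in>S \<inter> {a..b}. g s * indicator {s} t))
      \<in> borel_measurable borel" by (rule borel_measurable_add)
  moreover have "(\<Sum>s\<in>S \<inter> {a..b}. g s * indicator {s} t) = indicator (S \<inter> {a..b}) t * g t" for t
  proof -
    have "(\<Sum>s\<in>S \<inter> {a..b}. g s * indicator {s} t) = (\<Sum>s\<in>S \<inter> {a..b}. if s = t then g t else 0)"
      by (rule sum.cong) (auto simp: indicator_def)
    then show ?thesis using S(1) by (simp add: indicator_def)
  qed
  moreover have "indicator ({a..b} - S) t *\<^sub>R g t + indicator (S \<inter> {a..b}) t * g t = indicator {a..b} t * g t" for t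
    by (auto simp: indicator_def)
  ultimately show ?thesis by simp
qed

section \<open>Convergence rates\<close>

text \<open>The linear core of the theorem for one fixed parameter. \<open>D\<close> controls the
  approximation error; \<open>B * C\<close> bounds \<open>t * (f t)\<^sup>2\<close>, as the product
  of \<open>f t\<close> and \<open>t * f t\<close>, and its root controls the data error.\<close>

lemma source_condition_error:
  fixes A :: "'a::{real_inner, complete_space} \<Rightarrow> 'b::{real_inner, complete_space}"
    and f :: "real \<Rightarrow> real"
  defines "b \<equiv> onorm (adjoint A \<circ> A)"
  assumes A: "bounded_linear A" and \<mu>: "0 < \<mu>"
    and pc: "piecewise_continuous_on 0 b f"
    and fB: "\<And>t. t \<in> {0..b} \<Longrightarrow> \<bar>f t\<bar> \<le> B"
    and fC: "\<And>t. t \<in> {0..b} \<Longrightarrow> \<bar>t * f t\<bar> \<le> C"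
    and fD: "\<And>t. t \<in> {0..b} \<Longrightarrow> t powr \<mu> * \<bar>1 - t * f t\<bar> \<le> D"
  shows "norm (functional_calculus (adjoint A \<circ> A) f (adjoint A y) - source_operator A \<mu> w)
    \<le> D * norm w + sqrt (B * C) * norm (A (source_operator A \<mu> w) - y)"
proof -
  define T where "T = adjoint A \<circ> A"
  define K where "K = {0..b}"
  note inner_A = inner_adjoint[OF A]
  interpret A: bounded_linear A by fact
  interpret A': bounded_linear "adjoint A" by (rule bounded_linear_adjoint[OF A])
  have T: "bounded_linear T"
    unfolding T_def o_def by (rule bounded_linear_compose[OF A'.bounded_linear_axioms A])
  have sa: "selfadjoint T"
    unfolding selfadjoint_def T_def o_def by (metis inner_A inner_commute)
  have Txx: "T x \<bullet> x = (norm (A x))\<^sup>2" for x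
    unfolding T_def o_def by (metis inner_A inner_commute power2_norm_eq_inner)
  have pos: "0 \<le> T x \<bullet> x" for x by (simp add: Txx)
  have b: "b = onorm T" by (simp add: b_def T_def)
  have "0 \<le> b" unfolding b by (rule onorm_pos_le[OF T])
  \<comment> \<open>Evaluating the three bounds at the point 0 shows that \<open>B\<close>,
    \<open>C\<close> and \<open>D\<close> are nonnegative.\<close>
  then have "0 \<in> {0..b}" by simp
  then have nn: "0 \<le> B" "0 \<le> C" "0 \<le> D"
    using fB[of 0] fC[of 0] fD[of 0] by auto
  let ?E = "spectral_resolution T"
  note res = spectral_resolution[OF T sa pos]
  have calc: "spectral_calculus (scalar_spectral_measure ?E) K (sets borel) indicator ?E"
    by (rule spectral_calculus_pvm[OF res(1)]) (use res(2) in \<open>simp_all add: K_def b\<close>)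
  interpret spectral_calculus "scalar_spectral_measure ?E" K "sets borel" indicator ?E
    by (rule calc)
  define F where "F t = indicator K t * f t" for t
  define H where "H t = indicator K t * t powr \<mu>" for t
  have F: "F \<in> bounded_borel_on K"
    unfolding F_def K_def
    by (rule bounded_borel_onI[where B = B, OF borel_measurable_piecewise_continuous[OF pc]])
      (use fB in auto)
  have H: "H \<in> bounded_borel_on K"
  proof (rule bounded_borel_onI[where B = "b powr \<mu>"])
    show "H \<in> borel_measurable borel" unfolding H_def K_def by measurable
    show "\<bar>H t\<bar> \<le> b powr \<mu>" if "t \<in> K" for t
      using that \<mu> by (simp add: H_def K_def powr_mono2)
  qed
  have I: "(\<lambda>t. t) \<in> bounded_borel_on K"
    by (rule bounded_borel_on_continuous) (auto simp: K_def intro: continuous_intros)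
  have OpI: "Op (\<lambda>t. t) = T"
  proof (rule Op_eqI[OF I T sa])
    show "T x \<bullet> x = (LINT t|scalar_spectral_measure ?E x. t)" for x
      using res(3) set_integral_full[OF m_sets m_supp, where f = "\<lambda>t. t"]
      by (simp add: has_spectral_integral_def K_def b)
  qed
  have "functional_calculus T f = Op F"
    unfolding F_def K_def b
    by (rule functional_calculus_eq_Op[OF calc[unfolded K_def b]]) (use F in \<open>simp add: F_def[abs_def] K_def b\<close>)
  then have FC: "functional_calculus (adjoint A \<circ> A) f = Op F" by (simp add: T_def)
  have SO: "source_operator A \<mu> = Op H"
    unfolding source_operator_def T_def[symmetric] H_def K_def b
    by (rule functional_calculus_eq_Op[OF calc[unfolded K_def b]]) (use H in \<open>simp add: H_def[abs_def] K_def b\<close>)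
  define z where "z = source_operator A \<mu> w"
  define v where "v = y - A z"
  interpret F: bounded_linear "Op F" by (rule bounded_linear_Op[OF F])
  have IH: "(\<lambda>t. t * H t) \<in> bounded_borel_on K" by (rule bounded_borel_on_mult[OF I H])
  have FIH: "(\<lambda>t. F t * (t * H t)) \<in> bounded_borel_on K" by (rule bounded_borel_on_mult[OF F IH])
  have "Op F (T z) - z = Op (\<lambda>t. F t * (t * H t) - H t) w"
  proof -
    have "T z = Op (\<lambda>t. t * H t) w" using Op_mult[OF I H, of w] by (simp add: OpI z_def SO)
    then have "Op F (T z) = Op (\<lambda>t. F t * (t * H t)) w" by (simp add: Op_mult[OF F IH])
    then show ?thesis by (simp add: Op_diff[OF FIH H] z_def SO)
  qed
  moreover have "norm (Op (\<lambda>t. F t * (t * H t) - H t) w) \<le> D * norm w"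
  proof (rule norm_Op_le)
    show "\<forall>t\<in>K. \<bar>F t * (t * H t) - H t\<bar> \<le> D"
    proof
      fix t assume t: "t \<in> K"
      have "F t * (t * H t) - H t = - (t powr \<mu> * (1 - t * f t))"
        using t by (simp add: F_def H_def algebra_simps)
      then have "\<bar>F t * (t * H t) - H t\<bar> = t powr \<mu> * \<bar>1 - t * f t\<bar>" by (simp add: abs_mult)
      then show "\<bar>F t * (t * H t) - H t\<bar> \<le> D" using fD[of t] t by (simp add: K_def)
    qed
  qed (use FIH H nn in auto)
  ultimately have approx: "norm (Op F (T z) - z) \<le> D * norm w" by simp

  \<comment> \<open>The propagated data error. A calculus for \<open>A \<circ> adjoint A\<close> on
    the data space is avoided by duality: \<open>Op F \<circ> adjoint A\<close> is adjoint to
    \<open>A \<circ> Op F\<close>, whose norm is computed from \<open>T\<close>, and pairing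
    \<open>u\<close> with itself transfers the bound.\<close>
  define u where "u = Op F (adjoint A v)"
  have IF: "(\<lambda>t. t * F t) \<in> bounded_borel_on K" by (rule bounded_borel_on_mult[OF I F])
  have FIF: "(\<lambda>t. F t * (t * F t)) \<in> bounded_borel_on K" by (rule bounded_borel_on_mult[OF F IF])
  have "(norm (A (Op F u)))\<^sup>2 = T (Op F u) \<bullet> Op F u" by (simp add: Txx)
  also have "\<dots> = Op F (T (Op F u)) \<bullet> u"
    using selfadjoint_Op[OF F] by (simp add: selfadjoint_def)
  also have "\<dots> = Op (\<lambda>t. F t * (t * F t)) u \<bullet> u"
  proof -
    have "T (Op F u) = Op (\<lambda>t. t * F t) u" using Op_mult[OF I F, of u] by (simp add: OpI)
    then show ?thesis by (simp add: Op_mult[OF F IF])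
  qed
  also have "\<dots> \<le> \<bar>LINT t|scalar_spectral_measure ?E u. F t * (t * F t)\<bar>"
    by (simp add: Op_form[OF FIF])
  also have "\<dots> \<le> (B * C) * (norm u)\<^sup>2"
  proof (rule integral_m_bound[OF FIF], rule ballI)
    fix t assume t: "t \<in> K"
    then have "\<bar>f t\<bar> * \<bar>t * f t\<bar> \<le> B * C"
      using fB[of t] fC[of t] nn by (intro mult_mono) (auto simp: K_def)
    then show "\<bar>F t * (t * F t)\<bar> \<le> B * C" using t by (simp add: F_def abs_mult)
  qed
  finally have "(norm (A (Op F u)))\<^sup>2 \<le> (B * C) * (norm u)\<^sup>2" .
  then have AFu: "norm (A (Op F u)) \<le> sqrt (B * C) * norm u"
  proof -
    have "norm (A (Op F u)) \<le> sqrt ((B * C) * (norm u)\<^sup>2)"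
      using \<open>(norm (A (Op F u)))\<^sup>2 \<le> (B * C) * (norm u)\<^sup>2\<close> by (rule real_le_rsqrt)
    then show ?thesis by (simp only: real_sqrt_mult real_sqrt_abs abs_norm_cancel)
  qed
  have "norm u * norm u = Op F (adjoint A v) \<bullet> u"
    by (simp add: u_def power2_norm_eq_inner[symmetric] power2_eq_square)
  also have "\<dots> = v \<bullet> A (Op F u)"
    using selfadjoint_Op[OF F] by (metis selfadjoint_def inner_A inner_commute)
  also have "\<dots> \<le> norm v * norm (A (Op F u))" by (rule norm_cauchy_schwarz)
  also have "\<dots> \<le> norm v * (sqrt (B * C) * norm u)" by (rule mult_left_mono[OF AFu]) simp
  finally have "norm u * norm u \<le> (sqrt (B * C) * norm v) * norm u" by (simp add: mult_ac)
  then have stable: "norm u \<le> sqrt (B * C) * norm v"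
    using nn by (cases "u = 0") auto

  have "Op F (adjoint A y) - z = u + (Op F (T z) - z)"
  proof -
    have "T z = adjoint A (A z)" by (simp add: T_def)
    then show ?thesis by (simp add: u_def v_def A'.diff F.diff)
  qed
  then have "norm (Op F (adjoint A y) - z) \<le> norm u + norm (Op F (T z) - z)"
    by (simp only: norm_triangle_ineq)
  then have "norm (Op F (adjoint A y) - z) \<le> sqrt (B * C) * norm v + D * norm w"
    using stable approx by linarith
  then show ?thesis by (simp add: FC z_def[symmetric] v_def norm_minus_commute add.commute)
qed

theorem theorem2p8:
  fixes A :: "'a::{real_inner, complete_space} \<Rightarrow> 'b::{real_inner, complete_space}"
    and \<Phi> :: "'a \<Rightarrow> 'a"
    and \<mu> \<rho> \<alpha>0 c1 c2 :: real
    and g :: "real \<Rightarrow> real \<Rightarrow> real"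
    and \<alpha>s :: "real \<Rightarrow> 'b \<Rightarrow> real"
  assumes "bounded_linear A"
    and "\<exists>L. L-lipschitz_on UNIV \<Phi>"
    and "range \<Phi> \<subseteq> {x. A x = 0}"
    and "\<mu> > 0" and "\<rho> > 0"
    and "regularizing_filter (onorm (adjoint A \<circ> A)) g"
    and "\<alpha>0 > 0" and "c1 > 0" and "c2 > 0"
    and "\<And>\<alpha> t. \<alpha> > 0 \<Longrightarrow> t \<in> {0..onorm (adjoint A \<circ> A)} \<Longrightarrow>
           t powr \<mu> * \<bar>1 - t * g \<alpha> t\<bar> \<le> c1 * \<alpha> powr \<mu>"
    and "\<And>\<alpha>. 0 < \<alpha> \<Longrightarrow> \<alpha> < \<alpha>0 \<Longrightarrow>
           (SUP t\<in>{0..onorm (adjoint A \<circ> A)}. ereal \<bar>g \<alpha> t\<bar>) \<le> ereal (c2 / \<alpha>)"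
    and "\<And>\<delta> y. \<delta> > 0 \<Longrightarrow> \<alpha>s \<delta> y > 0"
    and "same_order \<alpha>s (\<lambda>\<delta>. (\<delta> / \<rho>) powr (2 / (2 * \<mu> + 1)))"
  shows "(\<exists>c>0. \<forall>\<^sub>F \<delta> in at_right 0.
            Sup {ereal (norm (reconstruction A \<Phi> g (\<alpha>s \<delta> y) y - x)) | x y.
                   x \<in> source_set A \<Phi> \<mu> \<rho> \<and> norm (A x - y) \<le> \<delta>}
              \<le> ereal (c * \<delta> powr (2 * \<mu> / (2 * \<mu> + 1)) * \<rho> powr (1 / (2 * \<mu> + 1))))
       \<and> (\<forall>x \<in> range ((\<lambda>z. z + \<Phi> z) \<circ> source_operator A \<mu>). \<forall>y :: real \<Rightarrow> 'b.
            (\<forall>\<delta>>0. norm (A x - y \<delta>) \<le> \<delta>) \<longrightarrow>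
            (\<lambda>\<delta>. norm (reconstruction A \<Phi> g (\<alpha>s \<delta> (y \<delta>)) (y \<delta>) - x))
              \<in> O[at_right 0](\<lambda>\<delta>. \<delta> powr (2 * \<mu> / (2 * \<mu> + 1))))"
proof -
  interpret A: bounded_linear A by fact
  let ?b = "onorm (adjoint A \<circ> A)"
  \<comment> \<open>The identity \<open>2 * \<mu> * e + e = 1\<close> carries the balance: it makes
    \<open>s powr (- e) * s\<close> equal to \<open>s powr (2 * \<mu> * e)\<close>.\<close>
  define e where "e = 1 / (2 * \<mu> + 1)"
  have e: "0 < e" "2 * \<mu> * e + e = 1" "2 * \<mu> / (2 * \<mu> + 1) = 2 * \<mu> * e" "2 / (2 * \<mu> + 1) = 2 * e"
    using \<open>\<mu> > 0\<close> by (auto simp: e_def field_simps)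
  obtain L where L: "L-lipschitz_on UNIV \<Phi>" using assms(2) by blast
  have "0 \<le> L" using L by (rule lipschitz_on_nonneg)
  obtain C where "C > 0" and
    C: "Sup {ereal \<bar>t * g \<alpha> t\<bar> | \<alpha> t. \<alpha> > 0 \<and> t \<in> {0..?b}} \<le> ereal C"
    using assms(6) by (auto simp: regularizing_filter_def)
  have gC: "\<bar>t * g \<alpha> t\<bar> \<le> C" if "\<alpha> > 0" "t \<in> {0..?b}" for \<alpha> t
  proof -
    have "ereal \<bar>t * g \<alpha> t\<bar> \<le> Sup {ereal \<bar>t * g \<alpha> t\<bar> | \<alpha> t. \<alpha> > 0 \<and> t \<in> {0..?b}}"
      by (rule Sup_upper) (use that in blast)
    from order_trans[OF this C] show ?thesis by simp
  qed
  have gB: "\<bar>g \<alpha> t\<bar> \<le> c2 / \<alpha>" if "0 < \<alpha>" "\<alpha> < \<alpha>0" "t \<in> {0..?b}" for \<alpha> t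
  proof -
    have "ereal \<bar>g \<alpha> t\<bar> \<le> (SUP t\<in>{0..?b}. ereal \<bar>g \<alpha> t\<bar>)" by (rule SUP_upper[OF that(3)])
    from order_trans[OF this assms(11)[OF that(1,2)]] show ?thesis by simp
  qed
  have error: "norm (reconstruction A \<Phi> g \<alpha> y - (z + \<Phi> z)) \<le>
      (1 + L) * (c1 * \<alpha> powr \<mu> * norm w + sqrt (c2 / \<alpha> * C) * \<delta>)"
    if z: "z = source_operator A \<mu> w" and y: "norm (A (z + \<Phi> z) - y) \<le> \<delta>"
      and \<alpha>: "0 < \<alpha>" "\<alpha> < \<alpha>0" for z w y \<alpha> \<delta>
  proof -
    define p where "p = functional_calculus (adjoint A \<circ> A) (g \<alpha>) (adjoint A y)"
    have "A (\<Phi> z) = 0" using assms(3) by auto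
    then have y': "norm (A z - y) \<le> \<delta>" using y by (simp add: A.add)
    have "norm (p - z) \<le> c1 * \<alpha> powr \<mu> * norm w + sqrt (c2 / \<alpha> * C) * norm (A z - y)"
      unfolding p_def z
      by (rule source_condition_error)
        (use assms(1,4,6,10) gB gC \<alpha> in \<open>auto simp: regularizing_filter_def\<close>)
    also have "\<dots> \<le> c1 * \<alpha> powr \<mu> * norm w + sqrt (c2 / \<alpha> * C) * \<delta>"
      using y' \<open>c2 > 0\<close> \<open>C > 0\<close> \<alpha> by (intro add_left_mono mult_left_mono) auto
    finally have pz: "norm (p - z) \<le> c1 * \<alpha> powr \<mu> * norm w + sqrt (c2 / \<alpha> * C) * \<delta>" .
    have "norm (reconstruction A \<Phi> g \<alpha> y - (z + \<Phi> z)) = norm ((p - z) + (\<Phi> p - \<Phi> z))"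
      by (simp add: reconstruction_def p_def algebra_simps)
    also have "\<dots> \<le> norm (p - z) + L * norm (p - z)"
      using norm_triangle_ineq[of "p - z" "\<Phi> p - \<Phi> z"] lipschitz_onD[OF L, of p z]
      by (simp add: dist_norm)
    also have "\<dots> = (1 + L) * norm (p - z)" by (simp add: algebra_simps)
    also have "\<dots> \<le> (1 + L) * (c1 * \<alpha> powr \<mu> * norm w + sqrt (c2 / \<alpha> * C) * \<delta>)"
      by (rule mult_left_mono[OF pz]) (use \<open>0 \<le> L\<close> in simp)
    finally show ?thesis .
  qed
  obtain d1 d2 where "d1 > 0" "d2 > 0" and
    order: "\<forall>\<^sub>F \<delta> in at_right 0. \<forall>y. d1 * (\<delta> / \<rho>) powr (2 * e) \<le> \<alpha>s \<delta> y \<and> \<alpha>s \<delta> y \<le> d2 * (\<delta> / \<rho>) powr (2 * e)"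
    using assms(13) unfolding same_order_def e by blast
  \<comment> \<open>The factor of the data error: the lower constant \<open>d1\<close> enters here,
    since \<open>c2 / \<alpha>\<close> is largest for the smallest \<open>\<alpha>\<close>. The
    approximation error uses the upper constant \<open>d2\<close>.\<close>
  define k where "k = sqrt (c2 * C / d1)"
  have "k > 0" using \<open>c2 > 0\<close> \<open>C > 0\<close> \<open>d1 > 0\<close> by (simp add: k_def)
  \<comment> \<open>The bound \<open>c2 / \<alpha>\<close> is available only below
    \<open>\<alpha>0\<close>; the upper estimate of the parameter tends to 0 and so gets there
    uniformly in the data.\<close>
  have small: "\<forall>\<^sub>F \<delta> in at_right 0. d2 * (\<delta> / \<rho>) powr (2 * e) < \<alpha>0"
  proof (rule order_tendstoD(2))
    have pos: "\<forall>\<^sub>F \<delta> in at_right 0. (0::real) < \<delta>" by (rule eventually_at_right_less)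
    have "((\<lambda>\<delta>. \<delta> / \<rho>) \<longlongrightarrow> 0 / \<rho>) (at_right 0)" using \<open>\<rho> > 0\<close> by (intro tendsto_intros) auto
    then have "((\<lambda>\<delta>. (\<delta> / \<rho>) powr (2 * e)) \<longlongrightarrow> 0) (at_right 0)"
      using e(1) \<open>\<rho> > 0\<close> by (intro tendsto_zero_powrI[OF _ tendsto_const])
        (auto intro: eventually_mono[OF pos])
    then show "((\<lambda>\<delta>. d2 * (\<delta> / \<rho>) powr (2 * e)) \<longlongrightarrow> 0) (at_right 0)"
      using tendsto_mult[OF tendsto_const] by fastforce
  qed (rule assms(7))
  \<comment> \<open>Stated for every \<open>w\<close> with \<open>norm w\<close> explicit:
    \<open>norm w \<le> \<rho>\<close> yields the uniform bound, and a fixed \<open>w\<close> of any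
    size yields the rate on the whole range. The threshold for \<open>\<delta>\<close> does not
    depend on \<open>w\<close> or \<open>y\<close>.\<close>
  have rate: "\<forall>\<^sub>F \<delta> in at_right 0. \<forall>w y. norm (A (source_operator A \<mu> w + \<Phi> (source_operator A \<mu> w)) - y) \<le> \<delta> \<longrightarrow>
      norm (reconstruction A \<Phi> g (\<alpha>s \<delta> y) y - (source_operator A \<mu> w + \<Phi> (source_operator A \<mu> w)))
      \<le> (1 + L) * (c1 * d2 powr \<mu> * norm w + k * \<rho>) * (\<delta> / \<rho>) powr (2 * \<mu> * e)"
    using order small eventually_at_right_less[of "0::real"]
  proof eventually_elim
    case (elim \<delta>)
    \<comment> \<open>In terms of \<open>s\<close> both error contributions become multiples of
      \<open>s powr (2 * \<mu> * e)\<close>, with factors \<open>norm w\<close> and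
      \<open>\<rho>\<close>.\<close>
    define s where "s = \<delta> / \<rho>"
    have s: "s > 0" "\<delta> = \<rho> * s" using elim(3) \<open>\<rho> > 0\<close> by (auto simp: s_def)
    show ?case
    proof (intro allI impI)
      fix w y
      let ?z = "source_operator A \<mu> w"
      assume y: "norm (A (?z + \<Phi> ?z) - y) \<le> \<delta>"
      define \<alpha> where "\<alpha> = \<alpha>s \<delta> y"
      have \<alpha>: "0 < \<alpha>" "\<alpha> < \<alpha>0" "d1 * s powr (2 * e) \<le> \<alpha>" "\<alpha> \<le> d2 * s powr (2 * e)"
        using elim assms(12)[of \<delta> y] by (auto simp: \<alpha>_def s_def intro: le_less_trans)
      have "\<alpha> powr \<mu> \<le> (d2 * s powr (2 * e)) powr \<mu>"
        using \<alpha> \<open>\<mu> > 0\<close> by (intro powr_mono2) auto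
      also have "\<dots> = d2 powr \<mu> * s powr (2 * \<mu> * e)"
        using \<open>d2 > 0\<close> by (simp add: powr_mult powr_powr mult_ac)
      finally have 1: "\<alpha> powr \<mu> \<le> d2 powr \<mu> * s powr (2 * \<mu> * e)" .
      have "sqrt (c2 / \<alpha> * C) \<le> sqrt (c2 * C / (d1 * s powr (2 * e)))"
        using \<alpha> s \<open>d1 > 0\<close> \<open>c2 > 0\<close> \<open>C > 0\<close>
        by (simp add: divide_left_mono)
      also have "\<dots> = k * s powr (- e)"
      proof -
        have "s powr (2 * e) = (s powr e)\<^sup>2" using s by (simp add: powr_powr mult.commute flip: powr_realpow)
        then have "c2 * C / (d1 * s powr (2 * e)) = c2 * C / d1 * (s powr (- e))\<^sup>2"
          by (simp add: powr_minus field_simps)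
        then show ?thesis
          unfolding k_def by (simp only: real_sqrt_mult real_sqrt_abs abs_of_nonneg powr_ge_zero)
      qed
      finally have "sqrt (c2 / \<alpha> * C) * \<delta> \<le> k * s powr (- e) * \<delta>"
        using elim(3) by (intro mult_right_mono) auto
      also have "\<dots> = k * \<rho> * s powr (2 * \<mu> * e)"
      proof -
        have "s powr (2 * \<mu> * e) = s powr (- e + 1)"
          using e(2) by (intro arg_cong2[where f = "(powr)"]) auto
        also have "\<dots> = s powr (- e) * s" using s by (simp only: powr_add) simp
        finally show ?thesis by (simp add: s(2))
      qed
      finally have 2: "sqrt (c2 / \<alpha> * C) * \<delta> \<le> k * \<rho> * s powr (2 * \<mu> * e)" .
      have "norm (reconstruction A \<Phi> g \<alpha> y - (?z + \<Phi> ?z)) \<le>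
          (1 + L) * (c1 * \<alpha> powr \<mu> * norm w + sqrt (c2 / \<alpha> * C) * \<delta>)"
        by (rule error[OF refl y \<alpha>(1,2)])
      also have "\<dots> \<le> (1 + L) * (c1 * (d2 powr \<mu> * s powr (2 * \<mu> * e)) * norm w + k * \<rho> * s powr (2 * \<mu> * e))"
        using 1 2 \<open>0 \<le> L\<close> \<open>c1 > 0\<close> by (intro mult_left_mono add_mono mult_right_mono) auto
      also have "\<dots> = (1 + L) * (c1 * d2 powr \<mu> * norm w + k * \<rho>) * s powr (2 * \<mu> * e)"
        by (simp add: algebra_simps)
      finally show "norm (reconstruction A \<Phi> g (\<alpha>s \<delta> y) y - (?z + \<Phi> ?z))
          \<le> (1 + L) * (c1 * d2 powr \<mu> * norm w + k * \<rho>) * (\<delta> / \<rho>) powr (2 * \<mu> * e)"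
        by (simp add: \<alpha>_def s_def)
    qed
  qed
  show ?thesis
    unfolding e(3) e_def[symmetric]
  proof (intro conjI ballI allI impI)
    define c where "c = (1 + L) * (c1 * d2 powr \<mu> + k)"
    have "c > 0" using \<open>0 \<le> L\<close> \<open>c1 > 0\<close> \<open>k > 0\<close> by (simp add: c_def add_nonneg_pos)
    moreover have "\<forall>\<^sub>F \<delta> in at_right 0.
            Sup {ereal (norm (reconstruction A \<Phi> g (\<alpha>s \<delta> y) y - x)) | x y.
                   x \<in> source_set A \<Phi> \<mu> \<rho> \<and> norm (A x - y) \<le> \<delta>}
              \<le> ereal (c * \<delta> powr (2 * \<mu> * e) * \<rho> powr e)"
      using rate eventually_at_right_less[of "0::real"]
    proof eventually_elim
      case (elim \<delta>)
      \<comment> \<open>The factor \<open>\<rho>\<close> left over from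
        \<open>norm w \<le> \<rho>\<close> and from \<open>k * \<rho>\<close>, divided by
        \<open>\<rho> powr (2 * \<mu> * e)\<close>, is the power of \<open>\<rho>\<close>
        claimed.\<close>
      have "\<rho> powr e = \<rho> powr (1 - 2 * \<mu> * e)"
        using e(2) by (intro arg_cong2[where f = "(powr)"]) auto
      also have "\<dots> = \<rho> / \<rho> powr (2 * \<mu> * e)" using \<open>\<rho> > 0\<close> by (simp add: powr_diff)
      finally have "\<rho> powr e = \<rho> / \<rho> powr (2 * \<mu> * e)" .
      then have scale: "\<rho> * (\<delta> / \<rho>) powr (2 * \<mu> * e) = \<delta> powr (2 * \<mu> * e) * \<rho> powr e"
        using elim(2) \<open>\<rho> > 0\<close> by (simp add: powr_divide)
      show ?case
      proof (rule Sup_least)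
        fix r assume "r \<in> {ereal (norm (reconstruction A \<Phi> g (\<alpha>s \<delta> y) y - x)) | x y.
                   x \<in> source_set A \<Phi> \<mu> \<rho> \<and> norm (A x - y) \<le> \<delta>}"
        then obtain w y where w: "norm w \<le> \<rho>"
          and y: "norm (A (source_operator A \<mu> w + \<Phi> (source_operator A \<mu> w)) - y) \<le> \<delta>"
          and r: "r = ereal (norm (reconstruction A \<Phi> g (\<alpha>s \<delta> y) y -
            (source_operator A \<mu> w + \<Phi> (source_operator A \<mu> w))))"
          by (auto simp: source_set_def)
        have "norm (reconstruction A \<Phi> g (\<alpha>s \<delta> y) y - (source_operator A \<mu> w + \<Phi> (source_operator A \<mu> w)))
          \<le> (1 + L) * (c1 * d2 powr \<mu> * norm w + k * \<rho>) * (\<delta> / \<rho>) powr (2 * \<mu> * e)"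
          using elim(1) y by blast
        also have "\<dots> \<le> (1 + L) * (c1 * d2 powr \<mu> * \<rho> + k * \<rho>) * (\<delta> / \<rho>) powr (2 * \<mu> * e)"
          using w \<open>0 \<le> L\<close> \<open>c1 > 0\<close> \<open>k > 0\<close> \<open>\<rho> > 0\<close>
          by (intro mult_right_mono mult_left_mono add_mono) auto
        also have "\<dots> = c * (\<rho> * (\<delta> / \<rho>) powr (2 * \<mu> * e))"
          by (simp add: c_def algebra_simps)
        also have "\<dots> = c * \<delta> powr (2 * \<mu> * e) * \<rho> powr e" unfolding scale by simp
        finally show "r \<le> ereal (c * \<delta> powr (2 * \<mu> * e) * \<rho> powr e)" by (simp add: r)
      qed
    qed
    ultimately show "\<exists>c>0. \<forall>\<^sub>F \<delta> in at_right 0.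
            Sup {ereal (norm (reconstruction A \<Phi> g (\<alpha>s \<delta> y) y - x)) | x y.
                   x \<in> source_set A \<Phi> \<mu> \<rho> \<and> norm (A x - y) \<le> \<delta>}
              \<le> ereal (c * \<delta> powr (2 * \<mu> * e) * \<rho> powr e)" by blast
  next
    fix x and y :: "real \<Rightarrow> 'b"
    assume "x \<in> range ((\<lambda>z. z + \<Phi> z) \<circ> source_operator A \<mu>)" and y: "\<forall>\<delta>>0. norm (A x - y \<delta>) \<le> \<delta>"
    then obtain w where x: "x = source_operator A \<mu> w + \<Phi> (source_operator A \<mu> w)" by auto
    show "(\<lambda>\<delta>. norm (reconstruction A \<Phi> g (\<alpha>s \<delta> (y \<delta>)) (y \<delta>) - x)) \<in> O[at_right 0](\<lambda>\<delta>. \<delta> powr (2 * \<mu> * e))"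
    proof (rule bigoI)
      show "\<forall>\<^sub>F \<delta> in at_right 0. norm (norm (reconstruction A \<Phi> g (\<alpha>s \<delta> (y \<delta>)) (y \<delta>) - x)) \<le>
          ((1 + L) * (c1 * d2 powr \<mu> * norm w + k * \<rho>) / \<rho> powr (2 * \<mu> * e)) * norm (\<delta> powr (2 * \<mu> * e))"
        using rate eventually_at_right_less[of "0::real"]
      proof eventually_elim
        case (elim \<delta>)
        then have "norm (reconstruction A \<Phi> g (\<alpha>s \<delta> (y \<delta>)) (y \<delta>) - x) \<le>
            (1 + L) * (c1 * d2 powr \<mu> * norm w + k * \<rho>) * (\<delta> / \<rho>) powr (2 * \<mu> * e)"
          using y by (simp add: x)
        then show ?case using elim(2) \<open>\<rho> > 0\<close> by (simp add: powr_divide)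
      qed
    qed
  qed
qed

end
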